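(* Let $\Omega\subset\mathbb C^n$ be a bounded domain and $p\ge1$. For all $z,w\in\Omega$: (1) $|K_p(z,w)|\le K_p(z)^{\frac1p}\,K_p(w)^{\frac1q}$, where $\frac1p+\frac1q=1$; (2) $\mathrm{Re}\{K_p(z,w)+K_p(w,z)\}\le K_p(z)+K_p(w)$. Each equality holds if and only if $z=w$.
   Context: For a bounded domain $\Omega\subset\mathbb C^n$ and $p\ge1$, $A^p(\Omega)$ is the space of holomorphic functions $f$ on $\Omega$ with $\|f\|_p^p:=\int_\Omega|f|^p<\infty$ (Lebesgue measure). Put $m_p(z):=\inf\{\|f\|_p: f\in A^p(\Omega),\ f(z)=1\}$. For $p\ge1$ the infimum is attained by exactly one function, denoted $m_p(\cdot,z)$ (so $m_p(\zeta,z)$ is its value at $\zeta$). Set $K_p(z):=m_p(z)^{-p}$ and $K_p(z,w):=m_p(z,w)K_p(w)$. For $p=1$, $1/q=0$. *)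

theory Defs
  imports "HOL-Analysis.Analysis"
begin

text \<open>
  Complex Frechet differentiability: the real derivative exists and is complex-linear. To be used
  for open \<open>\<Omega>\<close>.
\<close>
definition holomorphic_cn_on :: "(complex ^ 'n \<Rightarrow> complex) \<Rightarrow> (complex ^ 'n) set \<Rightarrow> bool" where
  "holomorphic_cn_on f \<Omega> \<longleftrightarrow>
     (\<forall>z\<in>\<Omega>. \<exists>f'. (f has_derivative f') (at z) \<and> (\<forall>c v. f' (c *s v) = c * f' v))"

definition domain_cn :: "(complex ^ 'n) set \<Rightarrow> bool" where
  "domain_cn \<Omega> \<longleftrightarrow> open \<Omega> \<and> connected \<Omega> \<and> \<Omega> \<noteq> {}"

text \<open>
  A function on \<open>\<Omega>\<close> is represented by its extension by zero to the whole space, so that two elements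
  of \<open>A\<^sup>p(\<Omega>)\<close> are equal as HOL functions iff they agree on \<open>\<Omega>\<close>.
\<close>
definition bergman_space :: "real \<Rightarrow> (complex ^ 'n) set \<Rightarrow> (complex ^ 'n \<Rightarrow> complex) set" where
  "bergman_space p \<Omega> =
     {f. holomorphic_cn_on f \<Omega> \<and> (\<forall>z. z \<notin> \<Omega> \<longrightarrow> f z = 0) \<and>
         set_integrable lborel \<Omega> (\<lambda>z. norm (f z) powr p)}"

definition bergman_norm :: "real \<Rightarrow> (complex ^ 'n) set \<Rightarrow> (complex ^ 'n \<Rightarrow> complex) \<Rightarrow> real" where
  "bergman_norm p \<Omega> f = (LINT z:\<Omega>|lborel. norm (f z) powr p) powr (1 / p)"

definition min_norm :: "real \<Rightarrow> (complex ^ 'n) set \<Rightarrow> complex ^ 'n \<Rightarrow> real" where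
  "min_norm p \<Omega> z = Inf {bergman_norm p \<Omega> f | f. f \<in> bergman_space p \<Omega> \<and> f z = 1}"

text \<open>\<open>minimizer p \<Omega> z\<close> is the function \<open>m\<^sub>p(\<cdot>, z)\<close>: the base point comes first here.\<close>
definition minimizer :: "real \<Rightarrow> (complex ^ 'n) set \<Rightarrow> complex ^ 'n \<Rightarrow> complex ^ 'n \<Rightarrow> complex" where
  "minimizer p \<Omega> z =
     (THE f. f \<in> bergman_space p \<Omega> \<and> f z = 1 \<and> bergman_norm p \<Omega> f = min_norm p \<Omega> z)"

definition bergman_kernel_diag :: "real \<Rightarrow> (complex ^ 'n) set \<Rightarrow> complex ^ 'n \<Rightarrow> real" where
  "bergman_kernel_diag p \<Omega> z = min_norm p \<Omega> z powr (- p)"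

definition bergman_kernel ::
    "real \<Rightarrow> (complex ^ 'n) set \<Rightarrow> complex ^ 'n \<Rightarrow> complex ^ 'n \<Rightarrow> complex" where
  "bergman_kernel p \<Omega> z w = minimizer p \<Omega> w z * complex_of_real (bergman_kernel_diag p \<Omega> w)"

text \<open>
  The conjugate exponent \<open>q\<close> of \<open>p \<ge> 1\<close> enters only through \<open>1 / q\<close>, given by \<open>1 / p + 1 / q = 1\<close>;
  in particular it is \<open>0\<close> for \<open>p = 1\<close>, where \<open>q\<close> is infinite.
\<close>
definition conj_exponent_recip :: "real \<Rightarrow> real" where
  "conj_exponent_recip p = 1 - 1 / p"

end

theory Submission
  imports Defs "HOL-Complex_Analysis.Great_Picard"
begin

text \<open>
  Write \<open>m(z)\<close> for \<open>min_norm p \<Omega> z\<close>. Dividing the minimiser at \<open>w\<close> by its value \<open>a\<close> at \<open>z\<close> gives a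
  competitor at \<open>z\<close>, so \<open>norm a \<le> m(w) / m(z)\<close>; multiplied by \<open>K\<^sub>p(w)\<close> this is the first inequality
  (lemmas \<open>norm_minimizer_le\<close> and \<open>bergman_kernel_bound\<close>). The second follows by Young's inequality.

  Equality means that the minimisers at \<open>z\<close> and at \<open>w\<close> are proportional. Multiplying the minimiser
  \<open>f\<close> at \<open>z\<close> by exponentials of small affine functions that vanish at \<open>z\<close> shows that \<open>z\<close> is the centre of
  mass of the measure with density \<open>norm f powr p\<close> (\<open>bergman_minimizer_barycenter\<close>). Proportional minimisers
  give the same measure up to a factor, hence the same centre of mass, and \<open>z = w\<close>.

  All this rests on the minimiser being well defined. It exists because a minimising sequence is
  locally bounded by the sub-mean value property, so that Montel's theorem (\<open>Montel_cn\<close>) and Fatou's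
  lemma apply. It is unique because two minimisers have equality in the triangle inequality at every
  point: their quotient is then real and holomorphic, hence constant, near the base point, and the
  identity theorem (\<open>identity_theorem_cn\<close>) does the rest. The several-variable facts are
  obtained from one-variable theory by restriction to complex lines.
\<close>

section \<open>Holomorphic functions of several complex variables\<close>

lemma norm_vector_smult:
  fixes v :: "complex ^ 'n"
  shows "norm (c *s v) = norm c * norm v"
  by (simp add: norm_vec_def vector_scalar_mult_def norm_mult L2_set_right_distrib)

lemma bounded_linear_smult_left:
  fixes v :: "complex ^ 'n"
  shows "bounded_linear (\<lambda>t. t *s v)"
proof (rule bounded_linear_intro)
  show "norm (t *s v) \<le> norm t * norm v" for t
    by (simp add: norm_vector_smult)
qed (simp_all add: vec_eq_iff algebra_simps)

lemma holomorphic_cn_on_subset: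
  "holomorphic_cn_on f S \<Longrightarrow> T \<subseteq> S \<Longrightarrow> holomorphic_cn_on f T"
  unfolding holomorphic_cn_on_def by blast

lemma holomorphic_cn_on_imp_continuous_on:
  "holomorphic_cn_on f S \<Longrightarrow> continuous_on S f"
  unfolding holomorphic_cn_on_def
  by (meson continuous_at_imp_continuous_on has_derivative_continuous)

lemma holomorphic_cn_on_const: "holomorphic_cn_on (\<lambda>_. c) S"
  unfolding holomorphic_cn_on_def by (auto intro!: exI[of _ "\<lambda>_. 0"])

lemma holomorphic_cn_on_component: "holomorphic_cn_on (\<lambda>x. x $ i) S"
  unfolding holomorphic_cn_on_def
proof
  fix z :: "complex ^ 'a"
  show "\<exists>f'. ((\<lambda>x. x $ i) has_derivative f') (at z) \<and> (\<forall>c v. f' (c *s v) = c * f' v)"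
    by (intro exI[of _ "\<lambda>x. x $ i"] conjI)
       (auto intro!: bounded_linear_imp_has_derivative bounded_linear_vec_nth)
qed

lemma holomorphic_cn_on_add:
  assumes "holomorphic_cn_on f S" "holomorphic_cn_on g S"
  shows "holomorphic_cn_on (\<lambda>x. f x + g x) S"
  unfolding holomorphic_cn_on_def
proof
  fix z assume "z \<in> S"
  then obtain f' g' where "(f has_derivative f') (at z)" "\<forall>c v. f' (c *s v) = c * f' v"
     "(g has_derivative g') (at z)" "\<forall>c v. g' (c *s v) = c * g' v"
    using assms unfolding holomorphic_cn_on_def by blast
  then show "\<exists>h'. ((\<lambda>x. f x + g x) has_derivative h') (at z) \<and> (\<forall>c v. h' (c *s v) = c * h' v)"
    by (intro exI[of _ "\<lambda>v. f' v + g' v"]) (auto intro!: derivative_eq_intros simp: algebra_simps)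
qed

lemma holomorphic_cn_on_mult:
  assumes "holomorphic_cn_on f S" "holomorphic_cn_on g S"
  shows "holomorphic_cn_on (\<lambda>x. f x * g x) S"
  unfolding holomorphic_cn_on_def
proof
  fix z assume "z \<in> S"
  then obtain f' g' where "(f has_derivative f') (at z)" "\<forall>c v. f' (c *s v) = c * f' v"
     "(g has_derivative g') (at z)" "\<forall>c v. g' (c *s v) = c * g' v"
    using assms unfolding holomorphic_cn_on_def by blast
  then show "\<exists>h'. ((\<lambda>x. f x * g x) has_derivative h') (at z) \<and> (\<forall>c v. h' (c *s v) = c * h' v)"
    by (intro exI[of _ "\<lambda>v. f z * g' v + f' v * g z"]) (auto intro!: derivative_eq_intros simp: algebra_simps)
qed

lemma holomorphic_cn_on_compose:
  assumes f: "holomorphic_cn_on f S" and h: "\<And>x. x \<in> S \<Longrightarrow> h field_differentiable at (f x)"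
  shows "holomorphic_cn_on (\<lambda>x. h (f x)) S"
  unfolding holomorphic_cn_on_def
proof
  fix z assume z: "z \<in> S"
  then obtain f' where f': "(f has_derivative f') (at z)" "\<forall>c v. f' (c *s v) = c * f' v"
    using f unfolding holomorphic_cn_on_def by blast
  obtain d where "(h has_field_derivative d) (at (f z))"
    using h[OF z] unfolding field_differentiable_def by blast
  then have "(h has_derivative (*) d) (at (f z))"
    by (rule has_field_derivative_imp_has_derivative)
  from has_derivative_compose[OF f'(1) this] f'(2)
  show "\<exists>h'. ((\<lambda>x. h (f x)) has_derivative h') (at z) \<and> (\<forall>c v. h' (c *s v) = c * h' v)"
    by (intro exI[of _ "\<lambda>v. d * f' v"]) auto
qed

text \<open>
  Restriction to a complex line turns a complex-linear Frechet derivative into an ordinary complex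
  derivative. This is how every fact of one-variable theory enters below.
\<close>
lemma has_field_derivative_along_line:
  fixes f :: "complex ^ 'n \<Rightarrow> complex"
  assumes "(f has_derivative f') (at (x + t *s v))" and lin: "\<And>c v. f' (c *s v) = c * f' v"
  shows "((\<lambda>s. f (x + s *s v)) has_field_derivative f' v) (at t)"
proof -
  have "((\<lambda>s. x + s *s v) has_derivative (\<lambda>s. s *s v)) (at t)"
    using has_derivative_add[OF has_derivative_const[of x]
        bounded_linear_imp_has_derivative[OF bounded_linear_smult_left[of v]]] by simp
  from has_derivative_compose[OF this assms(1)]
  show ?thesis
    by (simp add: has_field_derivative_def lin mult_commute_abs)
qed

lemma holomorphic_on_along_line:
  fixes f :: "complex ^ 'n \<Rightarrow> complex"
  assumes "holomorphic_cn_on f S"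
  shows "(\<lambda>t. f (x + t *s v)) holomorphic_on {t. x + t *s v \<in> S}"
  unfolding holomorphic_on_def field_differentiable_def
proof
  fix t assume "t \<in> {t. x + t *s v \<in> S}"
  then obtain f' where "(f has_derivative f') (at (x + t *s v))" "\<forall>c v. f' (c *s v) = c * f' v"
    using assms unfolding holomorphic_cn_on_def by blast
  then show "\<exists>d. ((\<lambda>t. f (x + t *s v)) has_field_derivative d) (at t within {t. x + t *s v \<in> S})"
    using has_field_derivative_along_line has_field_derivative_at_within by blast
qed

text \<open>
  In the direction \<open>v\<close> the restriction of \<open>f\<close> to the line through \<open>x\<close> is holomorphic on the disc of
  radius \<open>r / norm v\<close>, so the Cauchy inequality in one variable bounds its derivative at \<open>0\<close>,
  which is \<open>f' v\<close>.
\<close>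
lemma Cauchy_estimate_cn:
  fixes f :: "complex ^ 'n \<Rightarrow> complex"
  assumes hol: "holomorphic_cn_on f (cball x r)" and r: "r > 0"
    and M: "\<And>y. y \<in> cball x r \<Longrightarrow> norm (f y) \<le> M"
    and f': "(f has_derivative f') (at x)" "\<And>c v. f' (c *s v) = c * f' v"
  shows "norm (f' v) \<le> M / r * norm v"
proof (cases "v = 0")
  case True
  then show ?thesis using f'(2)[of 0 v] by simp
next
  case False
  define R where "R = r / norm v"
  have R: "R > 0" using r False by (simp add: R_def)
  let ?g = "\<lambda>t. f (x + t *s v)"
  have in_ball: "x + t *s v \<in> cball x r" if "t \<in> cball 0 R" for t
    using that False by (simp add: dist_norm norm_vector_smult R_def field_simps)
  have "?g holomorphic_on cball 0 R"
    by (rule holomorphic_on_subset[OF holomorphic_on_along_line[OF hol]]) (use in_ball in auto)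
  then have "norm ((deriv ^^ 1) ?g 0) \<le> fact 1 * M / R ^ 1"
  proof (intro Cauchy_inequality R holomorphic_on_imp_continuous_on)
    show "norm (f (x + t *s v)) \<le> M" if "norm (0 - t) = R" for t
      using M[OF in_ball[of t]] that by simp
  qed (auto intro: holomorphic_on_subset)
  moreover have "(?g has_field_derivative f' v) (at 0)"
    by (rule has_field_derivative_along_line) (use f' in simp_all)
  then have "deriv ?g 0 = f' v" by (rule DERIV_imp_deriv)
  ultimately show ?thesis by (simp add: R_def)
qed

text \<open>
  Each point of the half ball is the centre of a ball of radius \<open>r\<close> on which \<open>f\<close> is bounded by \<open>M\<close>;
  the Cauchy estimate there bounds the derivative. With a common \<open>M\<close>, this makes a family of
  holomorphic functions equicontinuous.
\<close>
lemma Lipschitz_on_half_ball: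
  fixes f :: "complex ^ 'n \<Rightarrow> complex"
  assumes hol: "holomorphic_cn_on f (cball a (2 * r))" and r: "r > 0"
    and M: "\<And>y. y \<in> cball a (2 * r) \<Longrightarrow> norm (f y) \<le> M"
    and xy: "x \<in> cball a r" "y \<in> cball a r"
  shows "norm (f x - f y) \<le> M / r * norm (x - y)"
proof -
  have sub: "cball u r \<subseteq> cball a (2 * r)" if "u \<in> cball a r" for u
    using that r by (auto simp: subset_iff) (smt (verit) dist_triangle)
  have "\<exists>f'. (f has_derivative f') (at u) \<and> (\<forall>c v. f' (c *s v) = c * f' v)" if "u \<in> cball a r" for u
    using that sub[OF that] r hol unfolding holomorphic_cn_on_def
    by (metis centre_in_cball less_eq_real_def subsetD)
  then obtain F where F: "\<And>u. u \<in> cball a r \<Longrightarrow> (f has_derivative F u) (at u)"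
     "\<And>u c v. u \<in> cball a r \<Longrightarrow> F u (c *s v) = c * F u v"
    by metis
  show ?thesis
  proof (rule differentiable_bound[OF convex_cball _ _ xy])
    fix u assume u: "u \<in> cball a r"
    show "(f has_derivative F u) (at u within cball a r)"
      using F(1)[OF u] by (rule has_derivative_at_withinI)
    show "onorm (F u) \<le> M / r"
    proof (rule onorm_le)
      show "norm (F u v) \<le> M / r * norm v" for v
        by (rule Cauchy_estimate_cn[OF holomorphic_cn_on_subset[OF hol sub[OF u]] r])
           (use sub[OF u] M F u in auto)
    qed
  qed
qed

section \<open>Rotation invariance and the sub-mean value property\<close>

lemma nn_integral_lborel_translate:
  fixes f :: "'a::euclidean_space \<Rightarrow> ennreal"
  assumes [measurable]: "f \<in> borel_measurable borel"
  shows "(\<integral>\<^sup>+x. f (c + x) \<partial>lborel) = (\<integral>\<^sup>+x. f x \<partial>lborel)"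
  by (subst (2) lborel_distr_plus[of c, symmetric]) (simp add: nn_integral_distr)

text \<open>
  The argument is the one that proves Haar measure unique: weighting with the unit ball \<open>B\<close> and
  integrating in the other order, translation invariance alone shows that
  \<open>(\<integral> f \<circ> T) * vol B\<close> equals the integral of \<open>f y * vol {x. norm (y - T x) < 1}\<close>. As \<open>T\<close> is an isometry,
  that set is again a ball of radius 1, and \<open>vol B\<close> cancels.
\<close>
lemma nn_integral_lborel_orthogonal:
  fixes f :: "'a::euclidean_space \<Rightarrow> ennreal" and T :: "'a \<Rightarrow> 'a"
  assumes [measurable]: "f \<in> borel_measurable borel" and T: "orthogonal_transformation T"
  shows "(\<integral>\<^sup>+x. f (T x) \<partial>lborel) = (\<integral>\<^sup>+x. f x \<partial>lborel)"
proof -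
  let ?B = "\<lambda>y::'a. indicator (ball 0 1) y :: ennreal" and ?v = "emeasure lborel (ball (0::'a) 1)"
  have lin: "linear T" and iso: "\<And>x. norm (T x) = norm x" and bij: "bij T"
    using T orthogonal_transformation_bij[OF T] by (auto simp: orthogonal_transformation)
  have [measurable]: "T \<in> borel_measurable borel"
    by (intro borel_measurable_continuous_onI linear_continuous_on) (simp add: lin linear_linear)
  have [measurable]: "ball (0::'a) 1 \<in> sets borel" by simp
  have T_inv: "T (inv T y) = y" for y
    using bij by (simp add: bij_is_surj surj_f_inv_f)
  have "(\<integral>\<^sup>+x. f (T x) \<partial>lborel) * ?v = (\<integral>\<^sup>+y. (\<integral>\<^sup>+x. f (T x) \<partial>lborel) * ?B y \<partial>lborel)"
    by (rule nn_integral_cmult_indicator[symmetric]) simp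
  also have "\<dots> = (\<integral>\<^sup>+y. (\<integral>\<^sup>+x. f (T (inv T y + x)) \<partial>lborel) * ?B y \<partial>lborel)"
    by (subst nn_integral_lborel_translate[of "\<lambda>x. f (T x)"]) simp_all
  also have "\<dots> = (\<integral>\<^sup>+y. (\<integral>\<^sup>+x. f (y + T x) * ?B y \<partial>lborel) \<partial>lborel)"
    by (simp add: linear_add[OF lin] T_inv nn_integral_multc)
  also have "\<dots> = (\<integral>\<^sup>+x. (\<integral>\<^sup>+y. f (y + T x) * ?B y \<partial>lborel) \<partial>lborel)"
    by (rule lborel_pair.Fubini') measurable
  also have "\<dots> = (\<integral>\<^sup>+x. (\<integral>\<^sup>+y. f y * ?B (y - T x) \<partial>lborel) \<partial>lborel)"
  proof (rule nn_integral_cong)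
    fix x
    show "(\<integral>\<^sup>+y. f (y + T x) * ?B y \<partial>lborel) = (\<integral>\<^sup>+y. f y * ?B (y - T x) \<partial>lborel)"
      using nn_integral_lborel_translate[of "\<lambda>y. f y * ?B (y - T x)" "T x"]
      by (simp add: add.commute)
  qed
  also have "\<dots> = (\<integral>\<^sup>+y. (\<integral>\<^sup>+x. f y * ?B (y - T x) \<partial>lborel) \<partial>lborel)"
    by (rule lborel_pair.Fubini') measurable
  also have "\<dots> = (\<integral>\<^sup>+y. f y * ?v \<partial>lborel)"
  proof (rule nn_integral_cong)
    fix y
    have "norm (y - T x) = dist (inv T y) x" for x
      by (metis T_inv dist_norm iso lin linear_diff)
    then have "?B (y - T x) = indicator (ball (inv T y) 1) x" for x
      by (simp add: indicator_def)
    then have "(\<integral>\<^sup>+x. f y * ?B (y - T x) \<partial>lborel) = f y * emeasure lborel (ball (inv T y) 1)"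
      by (simp only:) (rule nn_integral_cmult_indicator, simp)
    also have "emeasure lborel (ball (inv T y) 1) = ?v"
    proof -
      have fin: "emeasure lborel (ball c 1) = ennreal (measure lborel (ball c 1))" for c :: 'a
        using emeasure_lborel_ball_finite[of c 1] by (intro emeasure_eq_ennreal_measure) auto
      show ?thesis
        using content_ball_conv_unit_ball[of 1 "inv T y"] unfolding fin by simp
    qed
    finally show "(\<integral>\<^sup>+x. f y * ?B (y - T x) \<partial>lborel) = f y * ?v" .
  qed
  also have "\<dots> = (\<integral>\<^sup>+y. f y \<partial>lborel) * ?v"
    by (simp add: nn_integral_multc)
  finally have eq: "(\<integral>\<^sup>+x. f (T x) \<partial>lborel) * ?v = (\<integral>\<^sup>+x. f x \<partial>lborel) * ?v" .
  have "?v \<noteq> 0"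
    using content_ball_pos[of 1 "0::'a"] by (auto simp: Sigma_Algebra.measure_def)
  moreover have "?v \<noteq> \<infinity>" using emeasure_lborel_ball_finite[of "0::'a" 1] by simp
  ultimately show ?thesis
    using eq by (metis mult_divide_eq_ennreal infinity_ennreal_def)
qed

text \<open>
  The Cauchy integral formula at the centre of the circle, with the circle parametrised by \<open>[0, 1]\<close>.
\<close>
lemma norm_center_le_circle_mean:
  assumes hol: "g holomorphic_on cball 0 1"
  shows "ennreal (norm (g 0)) \<le>
    (\<integral>\<^sup>+t. ennreal (norm (g (exp (2 * of_real pi * \<i> * of_real t)))) * indicator {0..1::real} t \<partial>lborel)"
proof -
  let ?e = "\<lambda>t::real. exp (2 * of_real pi * \<i> * of_real t)"
  have "((\<lambda>u. g u / (u - 0)) has_contour_integral (2 * of_real pi * \<i> * g 0)) (circlepath 0 1)"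
    by (rule Cauchy_integral_circlepath_simple[OF hol]) simp
  then have "((\<lambda>t. (2 * of_real pi * \<i>) * g (?e t)) has_integral ((2 * of_real pi * \<i>) * g 0)) {0..1}"
    unfolding has_contour_integral_def
  proof (rule has_integral_eq[rotated])
    fix t :: real assume "t \<in> {0..1}"
    then show "g (circlepath 0 1 t) / (circlepath 0 1 t - 0) *
        vector_derivative (circlepath 0 1) (at t within {0..1}) = (2 * of_real pi * \<i>) * g (?e t)"
      by (subst vector_derivative_circlepath01) (auto simp: circlepath)
  qed
  from has_integral_mult_right[OF this, of "inverse (2 * of_real pi * \<i>)"]
  have int: "((\<lambda>t. g (?e t)) has_integral g 0) {0..1}"
    by (simp add: field_simps)
  have "continuous_on {0..1} (\<lambda>t. g (?e t))"
    by (rule continuous_on_compose2[OF holomorphic_on_imp_continuous_on[OF hol]])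
       (auto intro!: continuous_intros simp: norm_exp_eq_Re)
  then have si: "set_integrable lborel {0..1} (\<lambda>t. g (?e t))"
    by (rule borel_integrable_atLeastAtMost')
  have "g 0 = (LINT t:{0..1}|lborel. g (?e t))"
    using set_borel_integral_eq_integral(2)[OF si] int by (simp add: integral_unique)
  then have "ennreal (norm (g 0)) \<le> (\<integral>\<^sup>+t. norm (indicator {0..1} t *\<^sub>R g (?e t)) \<partial>lborel)"
    using integral_norm_bound_ennreal[OF si[unfolded set_integrable_def]]
    by (simp add: set_lebesgue_integral_def)
  also have "\<dots> = (\<integral>\<^sup>+t. ennreal (norm (g (?e t))) * indicator {0..1} t \<partial>lborel)"
    by (intro nn_integral_cong) (simp add: indicator_def)
  finally show ?thesis .
qed

lemma continuous_on_smult: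
  fixes g :: "'b::topological_space \<Rightarrow> complex ^ 'n"
  assumes "continuous_on S f" "continuous_on S g"
  shows "continuous_on S (\<lambda>x. f x *s g x)"
  unfolding vector_scalar_mult_def
  by (intro continuous_on_vec_lambda continuous_intros assms)

lemma orthogonal_transformation_smult:
  assumes "norm c = 1"
  shows "orthogonal_transformation (\<lambda>v::complex ^ 'n. c *s v)"
  unfolding orthogonal_transformation
proof
  show "linear (\<lambda>v::complex ^ 'n. c *s v)"
    by (rule linearI) (simp_all add: vec_eq_iff algebra_simps)
qed (simp add: norm_vector_smult assms)

text \<open>
  The sub-mean value property of \<open>norm f\<close> on balls. The ball is invariant under multiplication by
  unimodular scalars, so its integral can first be averaged over the circles
  \<open>t \<mapsto> exp (2 * pi * \<i> * t) *s v\<close>; on each of them the one-variable mean value inequality applies.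
\<close>
lemma norm_mult_volume_le_nn_integral_ball:
  fixes f :: "complex ^ 'n \<Rightarrow> complex"
  assumes hol: "holomorphic_cn_on f (cball x r)" and meas [measurable]: "f \<in> borel_measurable borel"
  shows "ennreal (norm (f x)) * emeasure lborel (ball (0::complex ^ 'n) r)
    \<le> (\<integral>\<^sup>+y. ennreal (norm (f y)) * indicator (ball x r) y \<partial>lborel)"
proof -
  let ?e = "\<lambda>t::real. exp (2 * of_real pi * \<i> * of_real t)"
  let ?B = "\<lambda>v::complex ^ 'n. indicator (ball 0 r) v :: ennreal"
  let ?I = "\<lambda>t::real. indicator {0..1} t :: ennreal"
  define F where "F = (\<lambda>v. ennreal (norm (f (x + v))) * ?B v)"
  have [measurable]: "ball (0::complex ^ 'n) r \<in> sets borel" "ball x r \<in> sets borel" by simp_all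
  have [measurable]: "F \<in> borel_measurable borel"
    unfolding F_def by measurable
  have [measurable]: "(\<lambda>p. ?e (snd p) *s (fst p :: complex ^ 'n)) \<in> borel_measurable (lborel \<Otimes>\<^sub>M lborel)"
    unfolding lborel_prod measurable_lborel1 measurable_lborel2
    by (intro borel_measurable_continuous_onI continuous_on_smult continuous_intros)
  have "ennreal (norm (f x)) * emeasure lborel (ball (0::complex ^ 'n) r)
      = (\<integral>\<^sup>+v. ennreal (norm (f x)) * ?B v \<partial>lborel)"
    by (rule nn_integral_cmult_indicator[symmetric]) simp
  also have "\<dots> \<le> (\<integral>\<^sup>+v. (\<integral>\<^sup>+t. F (?e t *s v) * ?I t \<partial>lborel) \<partial>lborel)"
  proof (rule nn_integral_mono)
    fix v :: "complex ^ 'n"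
    show "ennreal (norm (f x)) * ?B v \<le> (\<integral>\<^sup>+t. F (?e t *s v) * ?I t \<partial>lborel)"
    proof (cases "norm v < r")
      case True
      have "{t. norm t \<le> 1} \<subseteq> {t. x + t *s v \<in> cball x r}"
      proof clarify
        fix t :: complex assume "norm t \<le> 1"
        then have "norm t * norm v \<le> 1 * norm v" by (intro mult_right_mono) auto
        then show "x + t *s v \<in> cball x r" using True by (simp add: dist_norm norm_vector_smult)
      qed
      then have "(\<lambda>t. f (x + t *s v)) holomorphic_on cball 0 1"
        by (intro holomorphic_on_subset[OF holomorphic_on_along_line[OF hol]]) auto
      from norm_center_le_circle_mean[OF this]
      show ?thesis
        using True by (simp add: F_def norm_vector_smult norm_exp_eq_Re)
    qed simp
  qed
  also have "\<dots> = (\<integral>\<^sup>+t. (\<integral>\<^sup>+v. F (?e t *s v) * ?I t \<partial>lborel) \<partial>lborel)"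
    by (rule lborel_pair.Fubini'[symmetric]) measurable
  also have "\<dots> = (\<integral>\<^sup>+t. (\<integral>\<^sup>+v. F v \<partial>lborel) * ?I t \<partial>lborel)"
  proof (rule nn_integral_cong)
    fix t
    have [measurable]: "(\<lambda>v::complex ^ 'n. ?e t *s v) \<in> borel_measurable borel"
      by (intro borel_measurable_continuous_onI continuous_on_smult continuous_intros)
    have "(\<integral>\<^sup>+v. F (?e t *s v) \<partial>lborel) = (\<integral>\<^sup>+v. F v \<partial>lborel)"
      by (intro nn_integral_lborel_orthogonal orthogonal_transformation_smult) (simp_all add: norm_exp_eq_Re)
    then show "(\<integral>\<^sup>+v. F (?e t *s v) * ?I t \<partial>lborel) = (\<integral>\<^sup>+v. F v \<partial>lborel) * ?I t"
      by (simp add: nn_integral_multc)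
  qed
  also have "\<dots> = (\<integral>\<^sup>+v. F v \<partial>lborel)"
    by (subst nn_integral_cmult_indicator) simp_all
  also have "\<dots> = (\<integral>\<^sup>+v. ennreal (norm (f (x + v))) * indicator (ball x r) (x + v) \<partial>lborel)"
    unfolding F_def by (intro nn_integral_cong) (simp add: indicator_def dist_norm)
  also have "\<dots> = (\<integral>\<^sup>+y. ennreal (norm (f y)) * indicator (ball x r) y \<partial>lborel)"
    by (rule nn_integral_lborel_translate) measurable
  finally show ?thesis .
qed

section \<open>Montel's theorem\<close>

text \<open>
  The usual \<open>\<epsilon>/3\<close> argument: by compactness finitely many points of the dense set come within \<open>d\<close> of
  every point of the ball, and the common Lipschitz constant transports the Cauchy property from them.
\<close>
lemma uniformly_Cauchy_if_Lipschitz_Cauchy_on_dense: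
  fixes F :: "nat \<Rightarrow> 'a::euclidean_space \<Rightarrow> 'b::real_normed_vector"
  assumes r: "r > 0" and Lip: "\<And>k x y. x \<in> cball a r \<Longrightarrow> y \<in> cball a r \<Longrightarrow> norm (F k x - F k y) \<le> L * norm (x - y)"
    and D: "\<And>X. open X \<Longrightarrow> X \<noteq> {} \<Longrightarrow> \<exists>d\<in>D. d \<in> X"
    and C: "\<And>x. x \<in> D \<Longrightarrow> x \<in> ball a r \<Longrightarrow> Cauchy (\<lambda>k. F k x)"
    and e: "e > 0"
  shows "\<exists>N. \<forall>m\<ge>N. \<forall>n\<ge>N. \<forall>x\<in>cball a r. norm (F m x - F n x) \<le> e"
proof -
  define c where "c = \<bar>L\<bar> + 1"
  have c: "c > 0" "L \<le> c" by (auto simp: c_def)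
  define d where "d = e / (3 * c)"
  have d: "d > 0" using e c by (simp add: d_def)
  have "cball a r \<subseteq> (\<Union>y\<in>D \<inter> ball a r. ball y d)"
  proof
    fix x assume "x \<in> cball a r"
    then have "x \<in> closure (ball a r)" using r by simp
    then obtain y' where "y' \<in> ball a r" "dist y' x < d"
      using d by (meson closure_approachable)
    then have "ball x d \<inter> ball a r \<noteq> {}" by (auto simp: dist_commute)
    then obtain y where "y \<in> D" "y \<in> ball x d \<inter> ball a r"
      using D[of "ball x d \<inter> ball a r"] by auto
    then show "x \<in> (\<Union>y\<in>D \<inter> ball a r. ball y d)"
      by (auto simp: dist_commute)
  qed
  then obtain C' where C': "C' \<subseteq> D \<inter> ball a r" "finite C'" "cball a r \<subseteq> (\<Union>y\<in>C'. ball y d)"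
    using compactE_image[OF compact_cball, of "D \<inter> ball a r" "\<lambda>y. ball y d" a r] by blast
  have "\<exists>N. \<forall>m\<ge>N. \<forall>n\<ge>N. norm (F m y - F n y) < e / 3" if y: "y \<in> C'" for y
  proof -
    have "Cauchy (\<lambda>k. F k y)" using C y C'(1) by blast
    then show ?thesis using e metric_CauchyD[of "\<lambda>k. F k y" "e / 3"] by (simp add: dist_norm)
  qed
  then obtain Nf where Nf: "\<And>y m n. y \<in> C' \<Longrightarrow> m \<ge> Nf y \<Longrightarrow> n \<ge> Nf y \<Longrightarrow> norm (F m y - F n y) < e / 3"
    by metis
  have "norm (F m x - F n x) \<le> e" if mn: "m \<ge> sum Nf C'" "n \<ge> sum Nf C'" and x: "x \<in> cball a r" for m n x
  proof -
    obtain y where y: "y \<in> C'" "dist x y < d"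
      using C'(3) x by (auto simp: dist_commute)
    have yb: "y \<in> cball a r" using y C' by auto
    have "L * norm (x - y) \<le> c * d"
      using y c by (intro mult_mono) (auto simp: dist_norm)
    also have "c * d = e / 3"
      using c by (simp add: d_def)
    finally have "L * norm (x - y) \<le> e / 3" .
    then have close: "norm (F k x - F k y) \<le> e / 3" for k
      using Lip[OF x yb, of k] by linarith
    have "Nf y \<le> sum Nf C'" using y C' by (intro member_le_sum) auto
    then have "norm (F m y - F n y) < e / 3" using Nf[OF y(1)] mn by (meson order_trans)
    moreover have "norm (F m x - F n x) \<le> norm (F m x - F m y) + norm (F m y - F n y) + norm (F n x - F n y)"
      using norm_triangle_ineq4[of "(F m x - F m y) + (F m y - F n y)" "F n x - F n y"]
        norm_triangle_ineq[of "F m x - F m y" "F m y - F n y"] by simp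
    ultimately show ?thesis using close[of m] close[of n] by linarith
  qed
  then show ?thesis by blast
qed

text \<open>
  The Cauchy estimate applied to the differences \<open>F m - F n\<close> shows that the derivatives are uniformly
  Cauchy on the half ball as well, so differentiation commutes with the limit. Complex linearity of
  the derivative passes to pointwise limits.
\<close>
lemma uniformly_Cauchy_limit_holomorphic:
  fixes F :: "nat \<Rightarrow> complex ^ 'n \<Rightarrow> complex"
  assumes hol: "\<And>k. holomorphic_cn_on (F k) (cball a r)" and r: "r > 0"
    and UC: "\<And>e. e > 0 \<Longrightarrow> \<exists>N. \<forall>m\<ge>N. \<forall>n\<ge>N. \<forall>x\<in>cball a r. norm (F m x - F n x) \<le> e"
  shows "\<exists>g. holomorphic_cn_on g (ball a (r / 2)) \<and> (\<forall>x\<in>ball a (r / 2). (\<lambda>k. F k x) \<longlonglongrightarrow> g x)"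
proof -
  let ?S = "ball a (r / 2)"
  have sub: "cball x (r / 2) \<subseteq> cball a r" if "x \<in> ?S" for x
    using that by (auto simp: subset_iff) (smt (verit) dist_triangle field_sum_of_halves)
  have inS: "x \<in> cball a r" if "x \<in> ?S" for x
    using that r by auto
  obtain F' where F': "\<And>k x. x \<in> ?S \<Longrightarrow> (F k has_derivative F' k x) (at x)"
     "\<And>k x c v. x \<in> ?S \<Longrightarrow> F' k x (c *s v) = c * F' k x v"
    using hol inS unfolding holomorphic_cn_on_def by metis
  have der: "\<exists>N. \<forall>m\<ge>N. \<forall>n\<ge>N. \<forall>x\<in>?S. \<forall>v. norm (F' m x v - F' n x v) \<le> e * norm v" if e: "e > 0" for e
  proof -
    have "e * (r / 2) > 0" using e r by simp
    from UC[OF this] obtain N where N: "\<And>m n x. m \<ge> N \<Longrightarrow> n \<ge> N \<Longrightarrow> x \<in> cball a r \<Longrightarrow> norm (F m x - F n x) \<le> e * (r / 2)"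
      by blast
    have "norm (F' m x v - F' n x v) \<le> e * norm v" if "m \<ge> N" "n \<ge> N" "x \<in> ?S" for m n x v
    proof -
      have "holomorphic_cn_on (\<lambda>x. F m x + (-1) * F n x) (cball x (r / 2))"
        by (intro holomorphic_cn_on_add holomorphic_cn_on_mult holomorphic_cn_on_const
              holomorphic_cn_on_subset[OF hol sub] that)
      then have "holomorphic_cn_on (\<lambda>x. F m x - F n x) (cball x (r / 2))" by simp
      then have "norm (F' m x v - F' n x v) \<le> (e * (r / 2)) / (r / 2) * norm v"
      proof (rule Cauchy_estimate_cn)
        show "((\<lambda>x. F m x - F n x) has_derivative (\<lambda>v. F' m x v - F' n x v)) (at x)"
          by (intro has_derivative_diff F' that)
      qed (use N sub[OF that(3)] F'(2) that r in \<open>auto simp: algebra_simps\<close>)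
      then show ?thesis using r by simp
    qed
    then show ?thesis by blast
  qed
  have "Cauchy (\<lambda>k. F' k x v)" if x: "x \<in> ?S" for x v
  proof (rule metric_CauchyI)
    fix e :: real assume e: "e > 0"
    let ?d = "e / (norm v + 1)"
    have "?d > 0" using e by (simp add: add_nonneg_pos)
    from der[OF this] obtain N where N: "\<And>m n. m \<ge> N \<Longrightarrow> n \<ge> N \<Longrightarrow> norm (F' m x v - F' n x v) \<le> ?d * norm v"
      using x by metis
    have "norm v / (norm v + 1) < 1" by (simp add: add_nonneg_pos)
    from mult_strict_left_mono[OF this e] have "?d * norm v < e" by simp
    then show "\<exists>M. \<forall>m\<ge>M. \<forall>n\<ge>M. dist (F' m x v) (F' n x v) < e"
      unfolding dist_norm by (intro exI[of _ N] allI impI) (rule order_le_less_trans[OF N])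
  qed
  then have "\<exists>l. (\<lambda>k. F' k x v) \<longlonglongrightarrow> l" if "x \<in> ?S" for x v
    using that convergent_eq_Cauchy by blast
  then obtain G where G: "\<And>x v. x \<in> ?S \<Longrightarrow> (\<lambda>k. F' k x v) \<longlonglongrightarrow> G x v"
    by metis
  have unif: "\<forall>\<^sub>F n in sequentially. \<forall>x\<in>?S. \<forall>v. norm (F' n x v - G x v) \<le> e * norm v" if e: "e > 0" for e
  proof -
    obtain N where N: "\<And>m n x v. m \<ge> N \<Longrightarrow> n \<ge> N \<Longrightarrow> x \<in> ?S \<Longrightarrow> norm (F' m x v - F' n x v) \<le> e * norm v"
      using der[OF e] by blast
    have "norm (F' n x v - G x v) \<le> e * norm v" if "n \<ge> N" "x \<in> ?S" for n x v
    proof (rule tendsto_upperbound)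
      show "(\<lambda>m. norm (F' n x v - F' m x v)) \<longlonglongrightarrow> norm (F' n x v - G x v)"
        by (intro tendsto_intros G that)
      show "\<forall>\<^sub>F m in sequentially. norm (F' n x v - F' m x v) \<le> e * norm v"
        using N that unfolding eventually_sequentially by blast
    qed simp
    then show ?thesis unfolding eventually_sequentially by blast
  qed
  have "Cauchy (\<lambda>k. F k a)"
  proof (rule metric_CauchyI)
    fix e :: real assume e: "e > 0"
    then obtain N where "\<And>m n. m \<ge> N \<Longrightarrow> n \<ge> N \<Longrightarrow> norm (F m a - F n a) \<le> e / 2"
      using UC[of "e / 2"] r by (metis centre_in_cball half_gt_zero less_eq_real_def)
    then show "\<exists>M. \<forall>m\<ge>M. \<forall>n\<ge>M. dist (F m a) (F n a) < e"
      unfolding dist_norm using e by (intro exI[of _ N]) (smt (verit) field_sum_of_halves)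
  qed
  then obtain l where l: "(\<lambda>k. F k a) \<longlonglongrightarrow> l"
    using convergent_eq_Cauchy by blast
  have "\<exists>g. \<forall>x\<in>?S. (\<lambda>n. F n x) \<longlonglongrightarrow> g x \<and> (g has_derivative G x) (at x within ?S)"
  proof (rule has_derivative_sequence)
    show "\<forall>\<^sub>F n in sequentially. \<forall>x\<in>?S. \<forall>v. norm (F' n x v - G x v) \<le> e * norm v" if "e > 0" for e
      by (rule unif[OF that])
    show "(F k has_derivative F' k x) (at x within ?S)" if "x \<in> ?S" for k x
      using F'(1)[OF that] by (rule has_derivative_at_withinI)
    show "(\<lambda>k. F k a) \<longlonglongrightarrow> l" by (rule l)
  qed (use r in auto)
  then obtain g where g: "\<And>x. x \<in> ?S \<Longrightarrow> (\<lambda>n. F n x) \<longlonglongrightarrow> g x"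
      "\<And>x. x \<in> ?S \<Longrightarrow> (g has_derivative G x) (at x within ?S)"
    by blast
  have "G x (c *s v) = c * G x v" if "x \<in> ?S" for x c v
  proof (rule LIMSEQ_unique[OF G[OF that]])
    show "(\<lambda>k. F' k x (c *s v)) \<longlonglongrightarrow> c * G x v"
      unfolding F'(2)[OF that] by (intro tendsto_intros G that)
  qed
  then have "holomorphic_cn_on g ?S"
    unfolding holomorphic_cn_on_def using g(2) at_within_open[OF _ open_ball] by metis
  then show ?thesis using g(1) by blast
qed

text \<open>
  A subsequence converging on a countable dense set converges locally uniformly, because the
  functions are locally equi-Lipschitz.
\<close>
theorem Montel_cn:
  fixes F :: "nat \<Rightarrow> complex ^ 'n \<Rightarrow> complex"
  assumes op: "open \<Omega>" and hol: "\<And>k. holomorphic_cn_on (F k) \<Omega>"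
    and bdd: "\<And>a r. r > 0 \<Longrightarrow> cball a (2 * r) \<subseteq> \<Omega> \<Longrightarrow> \<exists>M. \<forall>k. \<forall>x\<in>cball a r. norm (F k x) \<le> M"
  obtains s g where "strict_mono (s :: nat \<Rightarrow> nat)" "holomorphic_cn_on g \<Omega>"
    "\<And>x. x \<in> \<Omega> \<Longrightarrow> (\<lambda>k. F (s k) x) \<longlonglongrightarrow> g x"
proof -
  have room: "\<exists>r>0. cball a (c * r) \<subseteq> \<Omega>" if a: "a \<in> \<Omega>" and c: "c > 0" for a and c :: real
  proof -
    obtain e where "e > 0" "cball a e \<subseteq> \<Omega>"
      using op a open_contains_cball by blast
    then show ?thesis using c by (intro exI[of _ "e / c"]) simp
  qed
  obtain D :: "(complex ^ 'n) set" where D: "countable D" "\<And>X. open X \<Longrightarrow> X \<noteq> {} \<Longrightarrow> \<exists>d\<in>D. d \<in> X"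
    using countable_dense_exists[where 'a = "complex ^ 'n"] by blast
  have "\<exists>M>0. \<forall>k. norm (F k x) \<le> M" if x: "x \<in> \<Omega>" for x
  proof -
    obtain r where r: "r > 0" "cball x (2 * r) \<subseteq> \<Omega>" using room[OF x, of 2] by auto
    then obtain M where "\<forall>k. \<forall>y\<in>cball x r. norm (F k y) \<le> M" using bdd by blast
    then have "norm (F k x) \<le> \<bar>M\<bar> + 1" for k
      using r(1) by (smt (verit) centre_in_cball)
    then show ?thesis
      by (intro exI[of _ "\<bar>M\<bar> + 1"]) auto
  qed
  then obtain B where B: "\<And>x. x \<in> \<Omega> \<Longrightarrow> B x > 0" "\<And>x k. x \<in> \<Omega> \<Longrightarrow> norm (F k x) \<le> B x"
    by metis
  \<comment> \<open>The bound depends on the point; dividing by it gives a sequence bounded by 1 everywhere.\<close>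
  obtain s where s: "strict_mono (s :: nat \<Rightarrow> nat)"
      "\<And>x. x \<in> D \<inter> \<Omega> \<Longrightarrow> \<exists>l. (\<lambda>k. F (s k) x /\<^sub>R B x) \<longlonglongrightarrow> l"
  proof (rule function_convergent_subsequence[of "D \<inter> \<Omega>" "\<lambda>k x. F k x /\<^sub>R B x" 1])
    show "norm (F k x /\<^sub>R B x) \<le> 1" if "x \<in> D \<inter> \<Omega>" for k x
      using B[of x] that by (simp add: field_simps)
  qed (use D in auto)
  have C: "Cauchy (\<lambda>k. F (s k) x)" if x: "x \<in> D \<inter> \<Omega>" for x
  proof -
    obtain l where "(\<lambda>k. F (s k) x /\<^sub>R B x) \<longlonglongrightarrow> l" using s(2)[OF x] by blast
    from tendsto_scaleR[OF tendsto_const[of "B x"] this]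
    show ?thesis using B(1)[of x] x by (simp add: LIMSEQ_imp_Cauchy)
  qed
  have loc: "\<exists>\<rho> g. \<rho> > 0 \<and> holomorphic_cn_on g (ball a \<rho>) \<and> ball a \<rho> \<subseteq> \<Omega> \<and>
      (\<forall>x\<in>ball a \<rho>. (\<lambda>k. F (s k) x) \<longlonglongrightarrow> g x)" if a: "a \<in> \<Omega>" for a
  proof -
    obtain r where r: "r > 0" "cball a (4 * r) \<subseteq> \<Omega>" using room[OF a, of 4] by auto
    then have "2 * r > 0" "cball a (2 * (2 * r)) \<subseteq> \<Omega>" by simp_all
    from bdd[OF this] obtain M where M: "\<And>k x. x \<in> cball a (2 * r) \<Longrightarrow> norm (F k x) \<le> M"
      by blast
    have sub: "cball a (2 * r) \<subseteq> \<Omega>" "cball a r \<subseteq> \<Omega>" "ball a (r / 2) \<subseteq> \<Omega>"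
      using r by (force simp: subset_iff)+
    have Lip: "norm (F k x - F k y) \<le> M / r * norm (x - y)" if "x \<in> cball a r" "y \<in> cball a r" for k x y
      by (rule Lipschitz_on_half_ball[OF holomorphic_cn_on_subset[OF hol sub(1)] r(1) M that])
    have "\<exists>g. holomorphic_cn_on g (ball a (r / 2)) \<and> (\<forall>x\<in>ball a (r / 2). (\<lambda>k. F (s k) x) \<longlonglongrightarrow> g x)"
    proof (rule uniformly_Cauchy_limit_holomorphic[OF holomorphic_cn_on_subset[OF hol sub(2)] r(1)])
      fix e :: real assume "e > 0"
      then show "\<exists>N. \<forall>m\<ge>N. \<forall>n\<ge>N. \<forall>x\<in>cball a r. norm (F (s m) x - F (s n) x) \<le> e"
        by (intro uniformly_Cauchy_if_Lipschitz_Cauchy_on_dense[OF r(1) Lip D(2)] C)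
           (use sub(2) in auto)
    qed
    then obtain h where "holomorphic_cn_on h (ball a (r / 2))"
        "\<forall>x\<in>ball a (r / 2). (\<lambda>k. F (s k) x) \<longlonglongrightarrow> h x"
      by blast
    then show ?thesis using r(1) sub(3) by (intro exI[of _ "r / 2"] exI[of _ h]) auto
  qed
  define g where "g = (\<lambda>x. lim (\<lambda>k. F (s k) x))"
  have lim_g: "(\<lambda>k. F (s k) x) \<longlonglongrightarrow> g x" if x: "x \<in> \<Omega>" for x
  proof -
    obtain \<rho> h where "\<rho> > 0" "\<forall>y\<in>ball x \<rho>. (\<lambda>k. F (s k) y) \<longlonglongrightarrow> h y"
      using loc[OF x] by blast
    then have "(\<lambda>k. F (s k) x) \<longlonglongrightarrow> h x" by simp
    then show ?thesis unfolding g_def by (simp add: limI)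
  qed
  have "holomorphic_cn_on g \<Omega>"
    unfolding holomorphic_cn_on_def
  proof
    fix a assume a: "a \<in> \<Omega>"
    obtain \<rho> h where h: "\<rho> > 0" "holomorphic_cn_on h (ball a \<rho>)" "ball a \<rho> \<subseteq> \<Omega>"
      "\<And>x. x \<in> ball a \<rho> \<Longrightarrow> (\<lambda>k. F (s k) x) \<longlonglongrightarrow> h x"
      using loc[OF a] by blast
    have eq: "h x = g x" if "x \<in> ball a \<rho>" for x
      using LIMSEQ_unique[OF h(4)[OF that] lim_g] h(3) that by blast
    have "a \<in> ball a \<rho>" using h(1) by simp
    then obtain h' where h': "(h has_derivative h') (at a)" "\<forall>c v. h' (c *s v) = c * h' v"
      using h(2) unfolding holomorphic_cn_on_def by blast
    have "(g has_derivative h') (at a)"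
      by (rule has_derivative_transform_within_open[OF h'(1) open_ball _ eq]) (use h(1) in auto)
    then show "\<exists>f'. (g has_derivative f') (at a) \<and> (\<forall>c v. f' (c *s v) = c * f' v)"
      using h' by blast
  qed
  from that[OF s(1) this lim_g] show ?thesis .
qed

section \<open>The identity theorem and equality in the triangle inequality\<close>

text \<open>
  The line through \<open>b\<close> and \<open>y\<close> meets the ball in a convex, hence connected, open set of parameters,
  and \<open>f\<close> vanishes on it near the parameter \<open>0\<close> of \<open>b\<close>.
\<close>
lemma vanishing_on_open_imp_vanishing_on_ball:
  fixes f :: "complex ^ 'n \<Rightarrow> complex"
  assumes hol: "holomorphic_cn_on f (ball a r)" and U: "open U" "b \<in> U" "b \<in> ball a r"
    and zero: "\<And>x. x \<in> U \<Longrightarrow> f x = 0" and y: "y \<in> ball a r"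
  shows "f y = 0"
proof -
  let ?line = "\<lambda>t. b + t *s (y - b)"
  define N where "N = {t. ?line t \<in> ball a r}"
  have lin: "bounded_linear (\<lambda>t. t *s (y - b))" by (rule bounded_linear_smult_left)
  have cont: "continuous_on UNIV ?line"
    by (intro continuous_intros linear_continuous_on lin)
  have opens: "open {t. ?line t \<in> X}" if "open X" for X
    using open_vimage[OF that cont] by (simp add: vimage_def)
  have "N = (\<lambda>t. t *s (y - b)) -` ball (a - b) r"
    by (auto simp: N_def dist_norm algebra_simps)
  then have "connected N"
    using lin by (simp add: convex_connected convex_linear_vimage bounded_linear.linear)
  have "f (?line 1) = 0"
  proof (rule analytic_continuation_open[where s = "{t. ?line t \<in> U \<inter> ball a r}" and s' = N
        and f = "\<lambda>t. f (?line t)" and g = "\<lambda>_. 0" and z = 1])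
    show "open N"
      unfolding N_def by (rule opens[OF open_ball])
    show "open {t. ?line t \<in> U \<inter> ball a r}"
      by (rule opens[OF open_Int[OF U(1) open_ball]])
    show "{t. ?line t \<in> U \<inter> ball a r} \<noteq> {}"
      using U by (auto intro!: exI[of _ 0])
    show "(\<lambda>t. f (?line t)) holomorphic_on N"
      unfolding N_def by (rule holomorphic_on_along_line[OF hol])
    show "1 \<in> N" using y by (simp add: N_def)
  qed (use \<open>connected N\<close> zero in \<open>auto simp: N_def\<close>)
  then show ?thesis by simp
qed

text \<open>
  The interior \<open>A\<close> of the zero set is closed relative to \<open>\<Omega>\<close>: a ball inside \<open>\<Omega>\<close> that meets \<open>A\<close> lies
  in \<open>A\<close>, by the case of a ball.
\<close>
theorem identity_theorem_cn:
  fixes f :: "complex ^ 'n \<Rightarrow> complex"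
  assumes "open \<Omega>" "connected \<Omega>" and hol: "holomorphic_cn_on f \<Omega>"
    and U: "open U" "U \<noteq> {}" "U \<subseteq> \<Omega>" "\<And>x. x \<in> U \<Longrightarrow> f x = 0"
    and x: "x \<in> \<Omega>"
  shows "f x = 0"
proof -
  define A where "A = interior {x \<in> \<Omega>. f x = 0}"
  have A: "A \<subseteq> \<Omega>" "\<And>x. x \<in> A \<Longrightarrow> f x = 0"
    using interior_subset unfolding A_def by blast+
  have "open (\<Omega> - A)"
    unfolding open_contains_ball
  proof
    fix a assume a: "a \<in> \<Omega> - A"
    then obtain r where r: "r > 0" "ball a r \<subseteq> \<Omega>"
      using \<open>open \<Omega>\<close> open_contains_ball by blast
    have "b \<notin> A" if b: "b \<in> ball a r" for b
    proof
      assume "b \<in> A"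
      have "open A" by (simp add: A_def)
      from vanishing_on_open_imp_vanishing_on_ball
        [OF holomorphic_cn_on_subset[OF hol r(2)] this \<open>b \<in> A\<close> b A(2)]
      have "f y = 0" if "y \<in> ball a r" for y using that by blast
      then have "ball a r \<subseteq> A"
        unfolding A_def by (intro interior_maximal) (use r in auto)
      moreover have "a \<in> ball a r" using r(1) by simp
      ultimately show False using a by blast
    qed
    then show "\<exists>e>0. ball a e \<subseteq> \<Omega> - A" using r by auto
  qed
  moreover have "open A" by (simp add: A_def)
  moreover have "U \<subseteq> A"
    unfolding A_def by (intro interior_maximal) (use U in auto)
  ultimately have "\<Omega> - A = {}"
    using connectedD[OF \<open>connected \<Omega>\<close>, of A "\<Omega> - A"] A(1) U(2) by blast
  then show ?thesis using A(2) x by blast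
qed

text \<open>
  The derivative takes real values only, and by complex linearity so does \<open>\<i>\<close> times the derivative;
  hence it vanishes.
\<close>
lemma real_valued_holomorphic_constant_on_ball:
  fixes f :: "complex ^ 'n \<Rightarrow> complex"
  assumes hol: "holomorphic_cn_on f (ball a r)" and real: "\<And>x. x \<in> ball a r \<Longrightarrow> Im (f x) = 0"
    and x: "x \<in> ball a r"
  shows "f x = f a"
proof (rule has_derivative_zero_unique[OF convex_ball[of a r]])
  fix y assume y: "y \<in> ball a r"
  then obtain f' where f': "(f has_derivative f') (at y)" and lin: "\<And>c v. f' (c *s v) = c * f' v"
    using hol unfolding holomorphic_cn_on_def by blast
  have "((\<lambda>x. Im (f x)) has_derivative (\<lambda>v. Im (f' v))) (at y)"
    using f' by (rule has_derivative_Im)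
  moreover have "((\<lambda>x. Im (f x)) has_derivative (\<lambda>v. 0)) (at y)"
    by (rule has_derivative_transform_within_open[OF has_derivative_const[of 0] open_ball y]) (simp add: real)
  ultimately have Im0: "Im (f' v) = 0" for v
    using has_derivative_unique by metis
  have "Re (f' v) = 0" for v
    using Im0[of "\<i> *s v"] by (simp add: lin)
  with Im0 have "f' = (\<lambda>v. 0)" by (simp add: complex_eq_iff fun_eq_iff)
  with f' show "(f has_derivative (\<lambda>v. 0)) (at y within ball a r)"
    using has_derivative_at_withinI by blast
next
  have "0 \<le> dist a x" by simp
  then show "a \<in> ball a r" using x by (simp del: zero_le_dist)
qed (use x in auto)

text \<open>
  Equality in the triangle inequality says that \<open>f x\<close> and \<open>g x\<close> point in the same direction. Where
  \<open>g\<close> has no zero, \<open>f / g\<close> is therefore holomorphic and real, hence locally constant.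
\<close>
lemma eq_near_if_norm_add_eq:
  fixes f g :: "complex ^ 'n \<Rightarrow> complex"
  assumes op: "open \<Omega>" and f: "holomorphic_cn_on f \<Omega>" and g: "holomorphic_cn_on g \<Omega>"
    and z: "z \<in> \<Omega>" "f z = g z" "g z \<noteq> 0"
    and tri: "\<And>x. x \<in> \<Omega> \<Longrightarrow> norm (f x + g x) = norm (f x) + norm (g x)"
  obtains r where "r > 0" "ball z r \<subseteq> \<Omega>" "\<And>x. x \<in> ball z r \<Longrightarrow> f x = g x"
proof -
  have "continuous_on \<Omega> g" using g by (rule holomorphic_cn_on_imp_continuous_on)
  then have "open (\<Omega> \<inter> g -` (- {0}))"
    using op by (intro continuous_open_preimage) auto
  moreover have "z \<in> \<Omega> \<inter> g -` (- {0})" using z by simp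
  ultimately obtain r where r: "r > 0" "ball z r \<subseteq> \<Omega> \<inter> g -` (- {0})"
    by (meson openE)
  have "ball z r \<subseteq> \<Omega>" and nz: "\<And>x. x \<in> ball z r \<Longrightarrow> g x \<noteq> 0"
    using r(2) by auto
  note on_ball = holomorphic_cn_on_subset[OF _ this(1)]
  have "holomorphic_cn_on (\<lambda>x. inverse (g x)) (ball z r)"
    by (rule holomorphic_cn_on_compose[OF on_ball[OF g]
          field_differentiable_inverse[OF field_differentiable_ident nz]])
  from holomorphic_cn_on_mult[OF on_ball[OF f] this]
  have hol: "holomorphic_cn_on (\<lambda>x. f x * inverse (g x)) (ball z r)" .
  have "Im (f x * inverse (g x)) = 0" if x: "x \<in> ball z r" for x
  proof -
    have nz: "g x \<noteq> 0" and "x \<in> \<Omega>" using r x by auto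
    from norm_triangle_eq[THEN iffD1, OF tri[OF this(2)]]
    have "norm (f x) *\<^sub>R g x = norm (g x) *\<^sub>R f x" .
    then have "f x * inverse (g x) = of_real (norm (f x) / norm (g x))"
      using nz by (simp add: field_simps scaleR_conv_of_real)
    then show ?thesis by simp
  qed
  then have const: "f x * inverse (g x) = f z * inverse (g z)" if "x \<in> ball z r" for x
    using real_valued_holomorphic_constant_on_ball[OF hol _ that] by blast
  show ?thesis
  proof (rule that[OF r(1)])
    show "ball z r \<subseteq> \<Omega>" using r(2) by blast
    show "f x = g x" if x: "x \<in> ball z r" for x
    proof -
      have "g x \<noteq> 0" using r(2) x by blast
      then show ?thesis using const[OF x] z by (simp add: field_simps)
    qed
  qed
qed

lemma powr_midpoint_le:
  fixes a b p :: real
  assumes "a \<ge> 0" "b \<ge> 0" "p \<ge> 1"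
  shows "((a + b) / 2) powr p \<le> (a powr p + b powr p) / 2"
proof -
  have half: "(c / 2) powr p \<le> c powr p / 2" if "c \<ge> 0" for c :: real
  proof -
    have "(1 / 2 :: real) powr p \<le> (1 / 2) powr 1"
      using assms by (intro powr_mono') auto
    then have "c powr p * (1 / 2) powr p \<le> c powr p * (1 / 2)"
      by (intro mult_left_mono) auto
    then show ?thesis using that powr_mult[of c "1/2" p] by simp
  qed
  show ?thesis
  proof (cases "a = 0 \<or> b = 0")
    case True
    then show ?thesis using half[of a] half[of b] assms by auto
  next
    case False
    with assms have "a \<in> {0<..}" "b \<in> {0<..}" by auto
    from convex_onD[OF powr_convex[OF assms(3)], of "1/2", OF _ _ this]
    show ?thesis by (simp add: add_divide_distrib)
  qed
qed

text \<open>
  A continuous function that is nonzero at a point is nonzero on a ball, which has positive measure.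
\<close>
lemma AE_zero_imp_zero_on_open:
  fixes f :: "'a::euclidean_space \<Rightarrow> real"
  assumes op: "open \<Omega>" and cont: "continuous_on \<Omega> f" and ae: "AE x in lborel. f x = 0" and x: "x \<in> \<Omega>"
  shows "f x = 0"
proof (rule ccontr)
  assume "f x \<noteq> 0"
  have "open (\<Omega> \<inter> f -` (- {0}))"
    using op cont by (intro continuous_open_preimage) auto
  moreover have "x \<in> \<Omega> \<inter> f -` (- {0})" using x \<open>f x \<noteq> 0\<close> by simp
  ultimately obtain r where r: "r > 0" "ball x r \<subseteq> \<Omega> \<inter> f -` (- {0})"
    by (meson openE)
  have "AE y in lborel. y \<notin> ball x r"
    using ae by eventually_elim (use r in auto)
  then have "emeasure lborel (ball x r) = 0"
    by (subst (asm) AE_iff_measurable[of "ball x r"]) auto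
  then show False
    using content_ball_pos[OF r(1), of x] by (simp add: measure_def)
qed

section \<open>Existence and uniqueness of the minimiser\<close>

text \<open>
  The \<open>p\<close>-th power of the Bergman norm. The integral runs over the whole space, which is harmless
  because members of the Bergman space are extended by zero; no domain has to be carried along.
\<close>
definition lp_mass :: "real \<Rightarrow> (complex ^ 'n \<Rightarrow> complex) \<Rightarrow> real" where
  "lp_mass p f = (LINT x|lborel. norm (f x) powr p)"

text \<open>
  The property that singles out \<open>minimizer p \<Omega> z\<close>, stated as a predicate so that existence and
  uniqueness can be proved before the definite description is used.
\<close>
definition bergman_minimizer where
  "bergman_minimizer p \<Omega> z f \<longleftrightarrow>
     f \<in> bergman_space p \<Omega> \<and> f z = 1 \<and> bergman_norm p \<Omega> f = min_norm p \<Omega> z"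

lemma indicator_powr_norm:
  assumes "\<And>x. x \<notin> \<Omega> \<Longrightarrow> f x = 0"
  shows "indicator \<Omega> x * (norm (f x) powr p) = norm (f x) powr p"
  using assms by (cases "x \<in> \<Omega>") auto

lemma bergman_space_iff:
  "f \<in> bergman_space p \<Omega> \<longleftrightarrow> holomorphic_cn_on f \<Omega> \<and> (\<forall>x. x \<notin> \<Omega> \<longrightarrow> f x = 0) \<and>
     integrable lborel (\<lambda>x. norm (f x) powr p)"
  unfolding bergman_space_def set_integrable_def
  by (auto simp: indicator_powr_norm)

lemma lp_mass_nonneg: "lp_mass p f \<ge> 0"
  unfolding lp_mass_def by (rule Bochner_Integration.integral_nonneg) simp

lemma bergman_norm_eq:
  assumes "f \<in> bergman_space p \<Omega>"
  shows "bergman_norm p \<Omega> f = lp_mass p f powr (1 / p)"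
  using assms unfolding bergman_norm_def lp_mass_def set_lebesgue_integral_def bergman_space_iff
  by (simp add: indicator_powr_norm)

lemma lp_mass_eq:
  assumes "f \<in> bergman_space p \<Omega>" "p \<ge> 1"
  shows "lp_mass p f = bergman_norm p \<Omega> f powr p"
  using assms lp_mass_nonneg[of p f] by (simp add: bergman_norm_eq powr_powr)

lemma borel_measurable_bergman:
  assumes "open \<Omega>" "f \<in> bergman_space p \<Omega>"
  shows "f \<in> borel_measurable borel"
proof -
  have "(\<lambda>x. indicator \<Omega> x *\<^sub>R f x) \<in> borel_measurable borel"
    using assms by (intro borel_measurable_continuous_on_indicator)
      (auto simp: bergman_space_iff holomorphic_cn_on_imp_continuous_on)
  moreover have "(\<lambda>x. indicator \<Omega> x *\<^sub>R f x) = f"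
    using assms(2) by (auto simp: bergman_space_iff indicator_def)
  ultimately show ?thesis by simp
qed

lemma holomorphic_cn_on_cong:
  assumes op: "open S" and f: "holomorphic_cn_on f S" and eq: "\<And>x. x \<in> S \<Longrightarrow> f x = g x"
  shows "holomorphic_cn_on g S"
  unfolding holomorphic_cn_on_def
proof
  fix x assume x: "x \<in> S"
  then obtain f' where f': "(f has_derivative f') (at x)" "\<forall>c v. f' (c *s v) = c * f' v"
    using f unfolding holomorphic_cn_on_def by blast
  have "(g has_derivative f') (at x)"
    by (rule has_derivative_transform_within_open[OF f'(1) op x eq])
  then show "\<exists>g'. (g has_derivative g') (at x) \<and> (\<forall>c v. g' (c *s v) = c * g' v)"
    using f'(2) by blast
qed

lemma emeasure_lborel_bounded:
  assumes "bounded (\<Omega> :: 'a::euclidean_space set)"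
  shows "emeasure lborel \<Omega> = ennreal (measure lborel \<Omega>)"
  using emeasure_bounded_finite[OF assms] by (intro emeasure_eq_ennreal_measure) auto

lemma bergman_space_bounded_mult:
  assumes op: "open \<Omega>" and f: "f \<in> bergman_space p \<Omega>" and h: "holomorphic_cn_on h \<Omega>"
    and B: "\<And>x. x \<in> \<Omega> \<Longrightarrow> norm (h x) \<le> B" and p: "p \<ge> 0"
  shows "(\<lambda>x. f x * h x) \<in> bergman_space p \<Omega>"
  unfolding bergman_space_iff
proof (intro conjI allI impI)
  show hol: "holomorphic_cn_on (\<lambda>x. f x * h x) \<Omega>"
    using f h by (simp add: bergman_space_iff holomorphic_cn_on_mult)
  show zero: "f x * h x = 0" if "x \<notin> \<Omega>" for x
    using f that by (simp add: bergman_space_iff)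
  have "(\<lambda>x. indicator \<Omega> x *\<^sub>R (f x * h x)) \<in> borel_measurable borel"
    using op by (intro borel_measurable_continuous_on_indicator holomorphic_cn_on_imp_continuous_on hol) simp
  moreover have "(\<lambda>x. indicator \<Omega> x *\<^sub>R (f x * h x)) = (\<lambda>x. f x * h x)"
    using f by (auto simp: bergman_space_iff indicator_def)
  ultimately have [measurable]: "(\<lambda>x. f x * h x) \<in> borel_measurable borel" by simp
  have "integrable lborel (\<lambda>x. norm (f x) powr p * B powr p)"
    using f by (intro integrable_mult_left) (simp add: bergman_space_iff)
  then show "integrable lborel (\<lambda>x. norm (f x * h x) powr p)"
  proof (rule Bochner_Integration.integrable_bound)
    have "norm (f x * h x) powr p \<le> norm (f x) powr p * B powr p" for x
    proof (cases "x \<in> \<Omega>")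
      case True
      then have "norm (h x) powr p \<le> B powr p" using B p by (intro powr_mono2) auto
      then show ?thesis by (simp add: norm_mult powr_mult mult_left_mono)
    next
      case False
      then have "f x = 0" using f by (simp add: bergman_space_iff)
      then show ?thesis by simp
    qed
    then show "AE x in lborel. norm (norm (f x * h x) powr p) \<le> norm (norm (f x) powr p * B powr p)"
      by (simp add: abs_mult)
  qed measurable
qed

lemma one_in_bergman_space:
  assumes "open \<Omega>" "bounded \<Omega>"
  shows "(\<lambda>x. if x \<in> \<Omega> then 1 else 0) \<in> bergman_space p \<Omega>"
  unfolding bergman_space_iff
proof (intro conjI allI impI)
  show "holomorphic_cn_on (\<lambda>x. if x \<in> \<Omega> then 1 else 0) \<Omega>"
    by (rule holomorphic_cn_on_cong[OF assms(1) holomorphic_cn_on_const[of 1]]) simp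
  have "integrable lborel (indicat_real \<Omega>)"
    using assms by (intro integrable_real_indicator emeasure_bounded_finite) auto
  moreover have "(\<lambda>x. norm (if x \<in> \<Omega> then 1 else 0 :: complex) powr p) = indicat_real \<Omega>"
    by (auto simp: indicator_def)
  ultimately show "integrable lborel (\<lambda>x. norm (if x \<in> \<Omega> then 1 else 0 :: complex) powr p)"
    by simp
qed auto

text \<open>
  Because \<open>t \<le> 1 + t powr p\<close> for \<open>t \<ge> 0\<close> and \<open>p \<ge> 1\<close>, and \<open>\<Omega>\<close> has finite volume, a bound on the
  \<open>p\<close>-th power of the norm bounds the integral of \<open>norm f\<close>. The sub-mean value property for exponent
  1 then bounds the values of \<open>f\<close> locally.
\<close>
lemma bergman_local_bound:
  fixes f :: "complex ^ 'n \<Rightarrow> complex"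
  assumes op: "open \<Omega>" and bd: "bounded \<Omega>" and p: "p \<ge> 1"
    and f: "f \<in> bergman_space p \<Omega>" and C: "lp_mass p f \<le> C" and sub: "cball x r \<subseteq> \<Omega>"
  shows "norm (f x) * measure lborel (ball (0::complex ^ 'n) r) \<le> measure lborel \<Omega> + C"
proof -
  have hol: "holomorphic_cn_on f \<Omega>" and int: "integrable lborel (\<lambda>x. norm (f x) powr p)"
    using f by (auto simp: bergman_space_iff)
  have [measurable]: "f \<in> borel_measurable borel" by (rule borel_measurable_bergman[OF op f])
  have [measurable]: "\<Omega> \<in> sets borel" using op by simp
  have "ennreal (norm (f x)) * emeasure lborel (ball (0::complex ^ 'n) r)
      \<le> (\<integral>\<^sup>+y. ennreal (norm (f y)) * indicator (ball x r) y \<partial>lborel)"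
    by (rule norm_mult_volume_le_nn_integral_ball[OF holomorphic_cn_on_subset[OF hol sub]]) simp
  also have "\<dots> \<le> (\<integral>\<^sup>+y. indicator \<Omega> y + ennreal (norm (f y) powr p) \<partial>lborel)"
  proof (rule nn_integral_mono)
    fix y
    have "norm (f y) \<le> 1 + norm (f y) powr p"
    proof (cases "norm (f y) \<le> 1")
      case True
      then show ?thesis using powr_ge_zero[of "norm (f y)" p] by linarith
    next
      case False
      then have "norm (f y) powr 1 \<le> norm (f y) powr p" using p by (intro powr_mono) auto
      then show ?thesis using False by simp
    qed
    then have "ennreal (norm (f y)) \<le> 1 + ennreal (norm (f y) powr p)"
      by (metis ennreal_1 ennreal_leI ennreal_plus powr_ge_zero zero_le_one)
    moreover have "y \<in> \<Omega>" if "y \<in> ball x r" using that sub by auto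
    ultimately show "ennreal (norm (f y)) * indicator (ball x r) y \<le> indicator \<Omega> y + ennreal (norm (f y) powr p)"
      by (auto simp: indicator_def)
  qed
  also have "\<dots> = emeasure lborel \<Omega> + (\<integral>\<^sup>+y. ennreal (norm (f y) powr p) \<partial>lborel)"
    by (subst nn_integral_add) auto
  also have "(\<integral>\<^sup>+y. ennreal (norm (f y) powr p) \<partial>lborel) = ennreal (lp_mass p f)"
    unfolding lp_mass_def by (rule nn_integral_eq_integral[OF int]) simp
  also have "emeasure lborel \<Omega> + ennreal (lp_mass p f) \<le> ennreal (measure lborel \<Omega> + C)"
    unfolding emeasure_lborel_bounded[OF bd]
    using C lp_mass_nonneg[of p f] by (subst ennreal_plus) (auto intro!: add_left_mono ennreal_leI)
  also have "emeasure lborel (ball (0::complex ^ 'n) r) = ennreal (measure lborel (ball (0::complex ^ 'n) r))"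
    by (rule emeasure_lborel_bounded) simp
  finally have ineq: "ennreal (norm (f x) * measure lborel (ball (0::complex ^ 'n) r)) \<le> ennreal (measure lborel \<Omega> + C)"
    by (simp only: ennreal_mult' norm_ge_zero)
  have "measure lborel \<Omega> + C \<ge> 0"
    using C lp_mass_nonneg[of p f] measure_nonneg[of lborel \<Omega>] by linarith
  from iffD1[OF ennreal_le_iff[OF this] ineq] show ?thesis .
qed

lemma min_norm_le:
  assumes "f \<in> bergman_space p \<Omega>" "f z = 1"
  shows "min_norm p \<Omega> z \<le> bergman_norm p \<Omega> f"
  unfolding min_norm_def
  by (rule cInf_lower) (use assms in \<open>auto intro!: bdd_belowI[of _ 0] simp: bergman_norm_def\<close>)

text \<open>
  Closed balls of \<open>A\<^sup>p(\<Omega>)\<close> are compact for locally uniform convergence: the local bounds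
  feed Montel's theorem, and the norm of the limit is controlled by Fatou's lemma. The bounds \<open>b k\<close> may
  vary with \<open>k\<close>, as they do along a minimising sequence.
\<close>
lemma bergman_limit:
  fixes F :: "nat \<Rightarrow> complex ^ 'n \<Rightarrow> complex"
  assumes op: "open \<Omega>" and bd: "bounded \<Omega>" and p: "p \<ge> 1"
    and F: "\<And>k. F k \<in> bergman_space p \<Omega>" and b: "\<And>k. lp_mass p (F k) \<le> b k"
    and lim: "b \<longlonglongrightarrow> C"
  obtains s h where "strict_mono (s :: nat \<Rightarrow> nat)" "h \<in> bergman_space p \<Omega>" "lp_mass p h \<le> C"
    "\<And>x. x \<in> \<Omega> \<Longrightarrow> (\<lambda>k. F (s k) x) \<longlonglongrightarrow> h x"
proof -
  obtain B where B: "\<And>k. b k \<le> B"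
    using convergent_imp_Bseq[of b] lim unfolding convergent_def Bseq_def real_norm_def
    by (metis abs_le_D1)
  have hol: "holomorphic_cn_on (F k) \<Omega>" for k using F by (simp add: bergman_space_iff)
  obtain s g where s: "strict_mono (s :: nat \<Rightarrow> nat)" and g: "holomorphic_cn_on g \<Omega>"
    and conv: "\<And>x. x \<in> \<Omega> \<Longrightarrow> (\<lambda>k. F (s k) x) \<longlonglongrightarrow> g x"
  proof (rule Montel_cn[OF op hol])
    fix a :: "complex ^ 'n" and r :: real assume r: "r > 0" "cball a (2 * r) \<subseteq> \<Omega>"
    let ?v = "measure lborel (ball (0::complex ^ 'n) r)"
    have v: "?v > 0" using r(1) by (rule content_ball_pos)
    have "norm (F k x) \<le> (measure lborel \<Omega> + B) / ?v" if x: "x \<in> cball a r" for k x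
    proof -
      have "cball x r \<subseteq> cball a (2 * r)" using x r(1) by (simp add: cball_subset_cball_iff dist_commute)
      then have "cball x r \<subseteq> \<Omega>" using r(2) by blast
      from bergman_local_bound[OF op bd p F order_trans[OF b B] this]
      show ?thesis using v by (simp add: field_simps)
    qed
    then show "\<exists>M. \<forall>k. \<forall>x\<in>cball a r. norm (F k x) \<le> M" by blast
  qed (rule that, assumption, assumption, blast)
  define h where "h = (\<lambda>x. if x \<in> \<Omega> then g x else 0)"
  have holh: "holomorphic_cn_on h \<Omega>"
    by (rule holomorphic_cn_on_cong[OF op g]) (simp add: h_def)
  have convh: "(\<lambda>k. F (s k) x) \<longlonglongrightarrow> h x" for x
    using conv[of x] F by (cases "x \<in> \<Omega>") (auto simp: h_def bergman_space_iff)
  have [measurable]: "F k \<in> borel_measurable borel" for k by (rule borel_measurable_bergman[OF op F])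
  have [measurable]: "h \<in> borel_measurable borel"
    by (rule borel_measurable_LIMSEQ_metric[OF _ convh]) simp
  have "(\<integral>\<^sup>+x. ennreal (norm (h x) powr p) \<partial>lborel)
      = (\<integral>\<^sup>+x. liminf (\<lambda>k. ennreal (norm (F (s k) x) powr p)) \<partial>lborel)"
  proof (rule nn_integral_cong)
    fix x
    have "(\<lambda>k. ennreal (norm (F (s k) x) powr p)) \<longlonglongrightarrow> ennreal (norm (h x) powr p)"
      using p by (intro tendsto_ennrealI tendsto_powr' tendsto_norm convh tendsto_const) auto
    then show "ennreal (norm (h x) powr p) = liminf (\<lambda>k. ennreal (norm (F (s k) x) powr p))"
      using lim_imp_Liminf[OF sequentially_bot] by metis
  qed
  also have "\<dots> \<le> liminf (\<lambda>k. \<integral>\<^sup>+x. ennreal (norm (F (s k) x) powr p) \<partial>lborel)"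
    by (rule nn_integral_liminf) measurable
  also have "\<dots> \<le> liminf (\<lambda>k. ennreal (b (s k)))"
  proof (intro Liminf_mono always_eventually allI)
    fix k
    have "(\<integral>\<^sup>+x. ennreal (norm (F (s k) x) powr p) \<partial>lborel) = ennreal (lp_mass p (F (s k)))"
      unfolding lp_mass_def using F by (intro nn_integral_eq_integral) (auto simp: bergman_space_iff)
    then show "(\<integral>\<^sup>+x. ennreal (norm (F (s k) x) powr p) \<partial>lborel) \<le> ennreal (b (s k))"
      using b by (simp add: ennreal_leI)
  qed
  also have "\<dots> = ennreal C"
    using LIMSEQ_subseq_LIMSEQ[OF lim s]
    by (intro lim_imp_Liminf sequentially_bot tendsto_ennrealI) (simp add: o_def)
  finally have fatou: "(\<integral>\<^sup>+x. ennreal (norm (h x) powr p) \<partial>lborel) \<le> ennreal C" .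
  then have int: "integrable lborel (\<lambda>x. norm (h x) powr p)"
    by (intro integrableI_nonneg) (auto intro: le_less_trans)
  have "b k \<ge> 0" for k using b[of k] lp_mass_nonneg[of p "F k"] by linarith
  then have "C \<ge> 0" using LIMSEQ_le_const[OF lim] by blast
  moreover have "ennreal (lp_mass p h) \<le> ennreal C"
    using fatou nn_integral_eq_integral[OF int] by (simp add: lp_mass_def)
  ultimately have "lp_mass p h \<le> C" by (simp add: ennreal_le_iff)
  moreover have "h \<in> bergman_space p \<Omega>"
    using holh int by (simp add: bergman_space_iff h_def)
  ultimately show ?thesis using that[OF s] convh by blast
qed

text \<open>
  A limit of a minimising sequence, whose members have norm at most \<open>m + 1 / (k + 1)\<close>.
\<close>
lemma bergman_minimizer_exists:
  assumes op: "open \<Omega>" and bd: "bounded \<Omega>" and p: "p \<ge> 1" and z: "z \<in> \<Omega>"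
  obtains f where "bergman_minimizer p \<Omega> z f"
proof -
  let ?S = "{bergman_norm p \<Omega> f | f. f \<in> bergman_space p \<Omega> \<and> f z = 1}" and ?m = "min_norm p \<Omega> z"
  have ne: "?S \<noteq> {}" using one_in_bergman_space[OF op bd] z by fastforce
  have m0: "?m \<ge> 0"
    unfolding min_norm_def using ne by (rule cInf_greatest) (auto simp: bergman_norm_def)
  have "\<exists>f. f \<in> bergman_space p \<Omega> \<and> f z = 1 \<and> bergman_norm p \<Omega> f < ?m + 1 / real (Suc k)" for k
    using cInf_lessD[OF ne, of "?m + 1 / real (Suc k)"] unfolding min_norm_def by auto
  then obtain F where F: "\<And>k. F k \<in> bergman_space p \<Omega>" "\<And>k. F k z = 1"
      "\<And>k. bergman_norm p \<Omega> (F k) < ?m + 1 / real (Suc k)"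
    by metis
  have b: "lp_mass p (F k) \<le> (?m + 1 / real (Suc k)) powr p" for k
    unfolding lp_mass_eq[OF F(1) p] using F(3)[of k] p
    by (intro powr_mono2) (auto simp: bergman_norm_def)
  have lim: "(\<lambda>k. (?m + 1 / real (Suc k)) powr p) \<longlonglongrightarrow> ?m powr p"
  proof (rule tendsto_powr')
    show "(\<lambda>k. ?m + 1 / real (Suc k)) \<longlonglongrightarrow> ?m"
      using tendsto_add[OF tendsto_const[of ?m] LIMSEQ_inverse_real_of_nat] by (simp add: inverse_eq_divide)
  qed (use m0 p in auto)
  obtain s h where h: "h \<in> bergman_space p \<Omega>" "lp_mass p h \<le> ?m powr p"
    and conv: "\<And>x. x \<in> \<Omega> \<Longrightarrow> (\<lambda>k. F (s k) x) \<longlonglongrightarrow> h x"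
    using bergman_limit[OF op bd p F(1) b lim] by blast
  have hz: "h z = 1" using conv[OF z] F(2) by (simp add: LIMSEQ_const_iff)
  have "bergman_norm p \<Omega> h \<le> (?m powr p) powr (1 / p)"
    unfolding bergman_norm_eq[OF h(1)] using h(2) p lp_mass_nonneg by (intro powr_mono2) auto
  then have "bergman_norm p \<Omega> h \<le> ?m" using m0 p by (simp add: powr_powr)
  with min_norm_le[OF h(1) hz] h(1) hz show ?thesis
    by (intro that[of h]) (simp add: bergman_minimizer_def)
qed

lemma bergman_minimizer_mass_le:
  assumes "bergman_minimizer p \<Omega> z f" "g \<in> bergman_space p \<Omega>" "g z = 1" "p \<ge> 1"
  shows "lp_mass p f \<le> lp_mass p g"
proof -
  have "bergman_norm p \<Omega> f \<le> bergman_norm p \<Omega> g"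
    using assms min_norm_le[of g p \<Omega> z] by (simp add: bergman_minimizer_def)
  moreover have "bergman_norm p \<Omega> f \<ge> 0" by (simp add: bergman_norm_def)
  moreover have "f \<in> bergman_space p \<Omega>" using assms(1) by (simp add: bergman_minimizer_def)
  ultimately show ?thesis
    using assms(2,4) powr_mono2[of p "bergman_norm p \<Omega> f" "bergman_norm p \<Omega> g"] lp_mass_eq by fastforce
qed

text \<open>
  An integral of zero would force \<open>f\<close> to vanish almost everywhere, hence everywhere on \<open>\<Omega>\<close>.
\<close>
lemma lp_mass_pos:
  assumes op: "open \<Omega>" and f: "f \<in> bergman_space p \<Omega>" and z: "z \<in> \<Omega>" "f z \<noteq> 0"
  shows "lp_mass p f > 0"
proof (rule ccontr)
  assume "\<not> lp_mass p f > 0"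
  then have "lp_mass p f = 0" using lp_mass_nonneg[of p f] by linarith
  then have "AE x in lborel. norm (f x) powr p = 0"
    unfolding lp_mass_def using f by (subst (asm) integral_nonneg_eq_0_iff_AE) (auto simp: bergman_space_iff)
  then have "AE x in lborel. norm (f x) = 0" by simp
  moreover have "continuous_on \<Omega> (\<lambda>x. norm (f x))"
    using f by (intro continuous_on_norm holomorphic_cn_on_imp_continuous_on) (simp add: bergman_space_iff)
  ultimately have "norm (f z) = 0" using AE_zero_imp_zero_on_open[OF op] z(1) by blast
  then show False using z(2) by simp
qed

text \<open>
  The average \<open>h\<close> of two minimisers also takes the value 1 at \<open>z\<close>, so its norm cannot be smaller.
  Therefore the nonnegative gap \<open>(norm f powr p + norm g powr p) / 2 - norm h powr p\<close> in the convexity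
  inequality has integral zero and vanishes identically on \<open>\<Omega>\<close>. This uses only the triangle
  inequality and plain convexity of \<open>t powr p\<close>, so it covers \<open>p = 1\<close>, where the norm is not strictly
  convex.
\<close>
lemma bergman_minimizer_norm_add:
  assumes op: "open \<Omega>" and p: "p \<ge> 1" and f: "bergman_minimizer p \<Omega> z f" and g: "bergman_minimizer p \<Omega> z g"
    and x: "x \<in> \<Omega>"
  shows "norm (f x + g x) = norm (f x) + norm (g x)"
proof -
  let ?h = "\<lambda>x. (f x + g x) / 2"
  let ?D = "\<lambda>x. (norm (f x) powr p + norm (g x) powr p) / 2 - norm (?h x) powr p"
  have fA: "f \<in> bergman_space p \<Omega>" and gA: "g \<in> bergman_space p \<Omega>"
    using f g by (auto simp: bergman_minimizer_def)
  have holf: "holomorphic_cn_on f \<Omega>" and intf: "integrable lborel (\<lambda>x. norm (f x) powr p)"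
    and holg: "holomorphic_cn_on g \<Omega>" and intg: "integrable lborel (\<lambda>x. norm (g x) powr p)"
    using fA gA by (auto simp: bergman_space_iff)
  have [measurable]: "f \<in> borel_measurable borel" "g \<in> borel_measurable borel"
    using borel_measurable_bergman[OF op] fA gA by auto
  have tri: "norm (?h y) \<le> (norm (f y) + norm (g y)) / 2" for y
    using norm_triangle_ineq[of "f y" "g y"] by (simp add: norm_divide)
  have mid: "norm (?h y) powr p \<le> ((norm (f y) + norm (g y)) / 2) powr p" for y
    using tri p by (intro powr_mono2) auto
  have conv: "((norm (f y) + norm (g y)) / 2) powr p \<le> (norm (f y) powr p + norm (g y) powr p) / 2" for y
    using p by (intro powr_midpoint_le) auto
  define I where "I = (LINT x|lborel. ?D x)"
  have D0: "?D y \<ge> 0" for y using mid[of y] conv[of y] by linarith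
  have int_avg: "integrable lborel (\<lambda>x. (norm (f x) powr p + norm (g x) powr p) / 2)"
    using intf intg by simp
  have inth: "integrable lborel (\<lambda>x. norm (?h x) powr p)"
  proof (rule Bochner_Integration.integrable_bound[OF int_avg])
    show "AE x in lborel. norm (norm (?h x) powr p) \<le> norm ((norm (f x) powr p + norm (g x) powr p) / 2)"
      using D0 by (intro AE_I2) simp
  qed measurable
  have "holomorphic_cn_on (\<lambda>x. (f x + g x) * (1 / 2)) \<Omega>"
    using holomorphic_cn_on_mult[OF holomorphic_cn_on_add[OF holf holg] holomorphic_cn_on_const] .
  then have "?h \<in> bergman_space p \<Omega>"
    using inth fA gA by (simp add: bergman_space_iff)
  moreover have "?h z = 1" using f g by (simp add: bergman_minimizer_def)
  ultimately have "lp_mass p f \<le> lp_mass p ?h" "lp_mass p g \<le> lp_mass p ?h"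
    using bergman_minimizer_mass_le f g p by blast+
  moreover have "I = (lp_mass p f + lp_mass p g) / 2 - lp_mass p ?h"
    unfolding I_def lp_mass_def using int_avg inth intf intg by simp
  moreover have "I \<ge> 0"
    unfolding I_def by (rule Bochner_Integration.integral_nonneg) (rule D0)
  ultimately have "I = 0" by argo
  then have "(LINT x|lborel. ?D x) = 0" unfolding I_def .
  then have "AE x in lborel. ?D x = 0"
    using D0 int_avg inth by (subst (asm) integral_nonneg_eq_0_iff_AE) auto
  moreover have "continuous_on \<Omega> ?D"
    using holomorphic_cn_on_imp_continuous_on[OF holf] holomorphic_cn_on_imp_continuous_on[OF holg] p
    by (intro continuous_intros continuous_on_powr') auto
  ultimately have "?D x = 0" using AE_zero_imp_zero_on_open[OF op _ _ x, of ?D] by blast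
  then have "((norm (f x) + norm (g x)) / 2) powr p \<le> norm (?h x) powr p" using conv[of x] by linarith
  then have "(norm (f x) + norm (g x)) / 2 \<le> norm (?h x)"
    using p powr_less_mono2[of p "norm (?h x)" "(norm (f x) + norm (g x)) / 2"] by force
  with norm_triangle_ineq[of "f x" "g x"] show ?thesis by (simp add: norm_divide)
qed

text \<open>
  Two minimisers have equality in the triangle inequality at every point and agree at \<open>z\<close>, so they agree
  near \<open>z\<close>, and the identity theorem propagates this over the connected set \<open>\<Omega>\<close>.
\<close>
lemma bergman_minimizer_unique:
  assumes op: "open \<Omega>" and con: "connected \<Omega>" and p: "p \<ge> 1" and z: "z \<in> \<Omega>"
    and f: "bergman_minimizer p \<Omega> z f" and g: "bergman_minimizer p \<Omega> z g"
  shows "f = g"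
proof
  fix x
  have f': "holomorphic_cn_on f \<Omega>" "f z = 1" "\<And>x. x \<notin> \<Omega> \<Longrightarrow> f x = 0"
    and g': "holomorphic_cn_on g \<Omega>" "g z = 1" "\<And>x. x \<notin> \<Omega> \<Longrightarrow> g x = 0"
    using f g by (auto simp: bergman_minimizer_def bergman_space_iff)
  obtain r where r: "r > 0" "ball z r \<subseteq> \<Omega>" "\<And>x. x \<in> ball z r \<Longrightarrow> f x = g x"
    by (rule eq_near_if_norm_add_eq[OF op f'(1) g'(1) z])
       (use f' g' bergman_minimizer_norm_add[OF op p f g] in auto)
  have "holomorphic_cn_on (\<lambda>x. f x + (-1) * g x) \<Omega>"
    by (rule holomorphic_cn_on_add[OF f'(1) holomorphic_cn_on_mult[OF holomorphic_cn_on_const g'(1)]])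
  from identity_theorem_cn[OF op con this, of "ball z r"]
  have "f x = g x" if "x \<in> \<Omega>" using that r by auto
  then show "f x = g x" using f'(3) g'(3) by metis
qed

lemma bergman_minimizer_minimizer:
  assumes "open \<Omega>" "connected \<Omega>" "bounded \<Omega>" "p \<ge> 1" "z \<in> \<Omega>"
  shows "bergman_minimizer p \<Omega> z (minimizer p \<Omega> z)"
proof -
  obtain f where f: "bergman_minimizer p \<Omega> z f"
    by (rule bergman_minimizer_exists[OF assms(1,3,4,5)])
  then have "\<exists>!f. bergman_minimizer p \<Omega> z f"
    using bergman_minimizer_unique[OF assms(1,2,4,5)] by blast
  from theI'[OF this] show ?thesis
    unfolding minimizer_def bergman_minimizer_def .
qed

section \<open>The minimiser determines its base point\<close>

lemma exp_le_quadratic: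
  fixes x :: real
  assumes "\<bar>x\<bar> \<le> 1"
  shows "exp x \<le> 1 + x + x\<^sup>2"
proof (cases "x \<ge> 0")
  case True
  then show ?thesis using assms by (intro exp_bound) auto
next
  case False
  define y where "y = - x"
  have y: "y > 0" using False by (simp add: y_def)
  have "(1 + y + y\<^sup>2 / 2) * (1 - y + y\<^sup>2) = 1 + (y ^ 2 + y ^ 3 + y ^ 4) / 2"
    by (simp add: eval_nat_numeral field_simps)
  then have "1 \<le> (1 + y + y\<^sup>2 / 2) * (1 - y + y\<^sup>2)"
    using y by simp
  also have "\<dots> \<le> exp y * (1 - y + y\<^sup>2)"
  proof (intro mult_right_mono exp_lower_Taylor_quadratic)
    show "0 \<le> 1 - y + y\<^sup>2" using assms by (simp add: y_def)
  qed (use y in auto)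
  finally have "exp (- y) * 1 \<le> exp (- y) * (exp y * (1 - y + y\<^sup>2))"
    by (intro mult_left_mono) auto
  then show ?thesis by (simp add: y_def mult.assoc[symmetric] exp_add[symmetric])
qed

text \<open>
  If \<open>I \<noteq> 0\<close>, the choice \<open>s = - c * I\<close> with a small \<open>c > 0\<close> makes the right-hand side negative.
\<close>
lemma linear_coefficient_zero:
  fixes I Q \<delta> :: real
  assumes d: "\<delta> > 0" and nonneg: "\<And>s. \<bar>s\<bar> \<le> \<delta> \<Longrightarrow> 0 \<le> s * I + s\<^sup>2 * Q"
  shows "I = 0"
proof (rule ccontr)
  assume I: "I \<noteq> 0"
  define c where "c = min (\<delta> / \<bar>I\<bar>) (1 / (\<bar>Q\<bar> + 1))"
  have c: "c > 0" using d I by (simp add: c_def add_nonneg_pos)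
  have "c \<le> \<delta> / \<bar>I\<bar>" by (simp add: c_def)
  then have "\<bar>- c * I\<bar> \<le> \<delta>" using I c by (simp add: abs_mult field_simps)
  from nonneg[OF this] have "0 \<le> (c * I\<^sup>2) * (c * Q - 1)"
    by (simp add: power2_eq_square algebra_simps)
  moreover have "c * I\<^sup>2 > 0" using c I by simp
  ultimately have "1 \<le> c * Q" by (simp add: zero_le_mult_iff)
  also have "\<dots> \<le> c * \<bar>Q\<bar>" using c by (intro mult_left_mono) auto
  also have "\<dots> \<le> 1 / (\<bar>Q\<bar> + 1) * \<bar>Q\<bar>" by (intro mult_right_mono) (auto simp: c_def)
  also have "\<dots> < 1" by (simp add: divide_less_eq add_nonneg_pos)
  finally show False by simp
qed

text \<open>
  The point \<open>z\<close> is the centre of mass of the measure with density \<open>norm f powr p\<close>, where \<open>f\<close> is the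
  minimiser at \<open>z\<close>; the statement gives the real part of coordinate \<open>i\<close> of this, multiplied by an arbitrary
  scalar \<open>c\<close>. To see it, compare \<open>f\<close> with the competitors \<open>f * exp (s / p * c * (x $ i - z $ i))\<close>: they take
  the value 1 at \<open>z\<close>, and the \<open>p\<close>-th power of their modulus is \<open>norm f powr p * exp (s * u)\<close> with
  \<open>u\<close> the real affine function in the statement. Minimality at \<open>s = 0\<close> kills the coefficient of \<open>s\<close>.
  An exponential factor has no zeros and needs no division by \<open>norm f\<close>, so the zeros of \<open>f\<close>
  cause no trouble even for \<open>p = 1\<close>.
\<close>
lemma bergman_minimizer_barycenter:
  fixes \<Omega> :: "(complex ^ 'n) set"
  assumes op: "open \<Omega>" and bd: "bounded \<Omega>" and p: "p \<ge> 1" and f: "bergman_minimizer p \<Omega> z f"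
  shows "integrable lborel (\<lambda>x. norm (f x) powr p * Re (c * (x $ i - z $ i)))"
    and "(LINT x|lborel. norm (f x) powr p * Re (c * (x $ i - z $ i))) = 0"
proof -
  let ?l = "\<lambda>x::complex ^ 'n. c * (x $ i - z $ i)" and ?u = "\<lambda>x::complex ^ 'n. Re (c * (x $ i - z $ i))"
  have fA: "f \<in> bergman_space p \<Omega>" and fz: "f z = 1" using f by (auto simp: bergman_minimizer_def)
  have intf: "integrable lborel (\<lambda>x. norm (f x) powr p)" and f0: "\<And>x. x \<notin> \<Omega> \<Longrightarrow> f x = 0"
    using fA by (auto simp: bergman_space_iff)
  have [measurable]: "f \<in> borel_measurable borel" by (rule borel_measurable_bergman[OF op fA])
  have [measurable]: "?u \<in> borel_measurable borel"
    by (intro borel_measurable_continuous_onI continuous_intros)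
  obtain K where K: "\<And>x. x \<in> \<Omega> \<Longrightarrow> norm x \<le> K"
    using bd by (auto simp: bounded_iff)
  \<comment> \<open>The summand 1 keeps R positive even when c is 0.\<close>
  define R where "R = norm c * (\<bar>K\<bar> + norm z) + 1"
  have R0: "R > 0" unfolding R_def by (intro add_nonneg_pos mult_nonneg_nonneg) auto
  have R: "norm (?l x) \<le> R" if "x \<in> \<Omega>" for x
  proof -
    have "norm (x $ i - z $ i) \<le> norm (x - z)"
      using Finite_Cartesian_Product.norm_nth_le[of "x - z" i] by simp
    also have "\<dots> \<le> \<bar>K\<bar> + norm z" using norm_triangle_ineq4[of x z] K[OF that] by linarith
    finally have "norm c * norm (x $ i - z $ i) \<le> norm c * (\<bar>K\<bar> + norm z)" by (rule mult_left_mono) simp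
    then show ?thesis by (simp add: R_def norm_mult)
  qed
  have uR: "\<bar>?u x\<bar> \<le> R" if "x \<in> \<Omega>" for x
    using abs_Re_le_cmod R[OF that] by (rule order_trans)
  have "integrable lborel (\<lambda>x. norm (f x) powr p * R)" using intf by simp
  then show intu: "integrable lborel (\<lambda>x. norm (f x) powr p * ?u x)"
  proof (rule Bochner_Integration.integrable_bound)
    have "\<bar>norm (f x) powr p * ?u x\<bar> \<le> \<bar>norm (f x) powr p * R\<bar>" for x
      using uR[of x] R0 f0[of x] by (cases "x \<in> \<Omega>") (auto simp: abs_mult intro!: mult_left_mono)
    then show "AE x in lborel. norm (norm (f x) powr p * ?u x) \<le> norm (norm (f x) powr p * R)"
      by simp
  qed measurable
  show "(LINT x|lborel. norm (f x) powr p * ?u x) = 0"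
  proof (rule linear_coefficient_zero[of "1 / R"])
    fix s :: real assume s: "\<bar>s\<bar> \<le> 1 / R"
    let ?h = "\<lambda>x. exp (of_real (s / p) * ?l x)"
    let ?g = "\<lambda>x. f x * ?h x"
    have sR: "\<bar>s\<bar> * R \<le> 1" using s R0 by (simp add: field_simps)
    have su: "\<bar>s * ?u x\<bar> \<le> 1" if "x \<in> \<Omega>" for x
    proof -
      have "\<bar>s\<bar> * \<bar>?u x\<bar> \<le> \<bar>s\<bar> * R" using uR[OF that] by (rule mult_left_mono) simp
      then show ?thesis using sR by (simp only: abs_mult)
    qed
    have holl: "holomorphic_cn_on (\<lambda>x. of_real (s / p) * (c * (x $ i + - z $ i))) \<Omega>"
      by (rule holomorphic_cn_on_mult[OF holomorphic_cn_on_const holomorphic_cn_on_mult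
          [OF holomorphic_cn_on_const holomorphic_cn_on_add[OF holomorphic_cn_on_component holomorphic_cn_on_const]]])
    have normh: "norm (?h x) = exp (s * ?u x / p)" for x
      unfolding norm_exp_eq_Re by simp
    have gA: "?g \<in> bergman_space p \<Omega>"
    proof (rule bergman_space_bounded_mult[OF op fA])
      show "holomorphic_cn_on ?h \<Omega>"
        using holomorphic_cn_on_compose[OF holl field_differentiable_within_exp] by simp
      show "norm (?h x) \<le> exp (1 / p)" if "x \<in> \<Omega>" for x
        unfolding normh using su[OF that] p by (simp add: divide_right_mono)
    qed (use p in simp)
    have normg: "norm (?g x) powr p = norm (f x) powr p * exp (s * ?u x)" for x
    proof -
      have "exp (s * ?u x / p) powr p = exp (s * ?u x)"
        using p by (simp add: exp_powr_real)
      then show ?thesis by (simp only: norm_mult normh powr_mult)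
    qed
    have intg: "integrable lborel (\<lambda>x. norm (f x) powr p * exp (s * ?u x))"
      using gA unfolding bergman_space_iff normg by blast
    have intq: "integrable lborel (\<lambda>x. norm (f x) powr p + s * (norm (f x) powr p * ?u x) + (s\<^sup>2 * R\<^sup>2) * norm (f x) powr p)"
      using intf intu by simp
    have "lp_mass p f \<le> lp_mass p ?g"
      by (rule bergman_minimizer_mass_le[OF f gA _ p]) (simp add: fz)
    also have "\<dots> = (LINT x|lborel. norm (f x) powr p * exp (s * ?u x))"
      unfolding lp_mass_def normg ..
    also have "\<dots> \<le> (LINT x|lborel. norm (f x) powr p + s * (norm (f x) powr p * ?u x) + (s\<^sup>2 * R\<^sup>2) * norm (f x) powr p)"
    proof (rule integral_mono[OF intg intq])
      fix x
      show "norm (f x) powr p * exp (s * ?u x) \<le>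
          norm (f x) powr p + s * (norm (f x) powr p * ?u x) + (s\<^sup>2 * R\<^sup>2) * norm (f x) powr p"
      proof (cases "x \<in> \<Omega>")
        case True
        have "(?u x)\<^sup>2 \<le> R\<^sup>2" using power_mono[OF uR[OF True] abs_ge_zero, of 2] by (simp only: power2_abs)
        then have "s\<^sup>2 * (?u x)\<^sup>2 \<le> s\<^sup>2 * R\<^sup>2" by (rule mult_left_mono) simp
        with exp_le_quadratic[OF su[OF True]]
        have "exp (s * ?u x) \<le> 1 + s * ?u x + s\<^sup>2 * R\<^sup>2" by (simp only: power_mult_distrib)
        then have "norm (f x) powr p * exp (s * ?u x) \<le> norm (f x) powr p * (1 + s * ?u x + s\<^sup>2 * R\<^sup>2)"
          by (rule mult_left_mono) simp
        also have "\<dots> = norm (f x) powr p + s * (norm (f x) powr p * ?u x) + (s\<^sup>2 * R\<^sup>2) * norm (f x) powr p"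
          by (simp only: algebra_simps)
        finally show ?thesis .
      qed (simp add: f0)
    qed
    also have "\<dots> = lp_mass p f + s * (LINT x|lborel. norm (f x) powr p * ?u x) + s\<^sup>2 * (R\<^sup>2 * lp_mass p f)"
      unfolding lp_mass_def using intf intu by simp
    finally show "0 \<le> s * (LINT x|lborel. norm (f x) powr p * ?u x) + s\<^sup>2 * (R\<^sup>2 * lp_mass p f)"
      by linarith
  qed (use R0 in simp)
qed

text \<open>
  Proportional minimisers define the same measure up to a factor, and a measure of positive total mass
  has only one centre of mass. The scalar \<open>c = cnj (w $ i - z $ i)\<close> turns the difference of the two
  barycentre identities into the square of \<open>norm (w $ i - z $ i)\<close>.
\<close>
lemma bergman_minimizers_proportional_imp_eq:
  fixes \<Omega> :: "(complex ^ 'n) set"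
  assumes op: "open \<Omega>" and bd: "bounded \<Omega>" and p: "p \<ge> 1" and w: "w \<in> \<Omega>"
    and f: "bergman_minimizer p \<Omega> w f" and g: "bergman_minimizer p \<Omega> z (\<lambda>x. f x / a)" and a: "a \<noteq> 0"
  shows "z = w"
proof -
  have "z $ i = w $ i" for i
  proof -
    define c where "c = cnj (w $ i - z $ i)"
    let ?I = "\<lambda>y::complex ^ 'n. \<lambda>x. norm (f x) powr p * Re (c * (x $ i - y $ i))"
    note bw = bergman_minimizer_barycenter[OF op bd p f, of c i]
    note bz = bergman_minimizer_barycenter[OF op bd p g, of c i]
    have scale: "norm (f x / a) powr p * t = (norm (f x) powr p * t) / norm a powr p" for x t
      by (simp add: norm_divide powr_divide)
    define A where "A = norm a powr p"
    define J where "J = ?I z"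
    have A: "A \<noteq> 0" using a by (simp add: A_def)
    have J: "integrable lborel (\<lambda>x. J x / A)" "(LINT x|lborel. J x / A) = 0"
      using bz unfolding scale J_def A_def by simp_all
    from integrable_mult_right[of A, OF J(1)] have "integrable lborel J"
      using A by simp
    moreover have "(LINT x|lborel. J x) = 0" using J(2) A by simp
    ultimately have "integrable lborel (?I z)" "(LINT x|lborel. ?I z x) = 0"
      by (simp_all only: J_def)
    with bw have "(LINT x|lborel. ?I z x - ?I w x) = 0"
      by (subst Bochner_Integration.integral_diff) simp_all
    also have "(\<lambda>x. ?I z x - ?I w x) = (\<lambda>x. norm (f x) powr p * Re (c * (w $ i - z $ i)))"
      by (simp add: fun_eq_iff algebra_simps)
    finally have "lp_mass p f * Re (c * (w $ i - z $ i)) = 0"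
      by (simp add: lp_mass_def)
    moreover have "lp_mass p f > 0"
      using lp_mass_pos[OF op _ w] f by (simp add: bergman_minimizer_def)
    ultimately have "Re (c * (w $ i - z $ i)) = 0" by simp
    moreover have "Re (cnj d * d) = (norm d)\<^sup>2" for d
      unfolding cmod_power2 by (simp add: power2_eq_square)
    ultimately have "(norm (w $ i - z $ i))\<^sup>2 = 0"
      unfolding c_def by metis
    then show ?thesis by simp
  qed
  then show ?thesis by (simp add: vec_eq_iff)
qed

section \<open>The kernel inequalities\<close>

lemma bergman_norm_divide:
  assumes op: "open \<Omega>" and p: "p \<ge> 1" and f: "f \<in> bergman_space p \<Omega>"
  shows "(\<lambda>x. f x / a) \<in> bergman_space p \<Omega>"
    and "bergman_norm p \<Omega> (\<lambda>x. f x / a) = bergman_norm p \<Omega> f / norm a"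
proof -
  have "(\<lambda>x. f x * inverse a) \<in> bergman_space p \<Omega>"
    by (rule bergman_space_bounded_mult[OF op f holomorphic_cn_on_const order_refl]) (use p in simp)
  then show A: "(\<lambda>x. f x / a) \<in> bergman_space p \<Omega>" by (simp add: divide_inverse)
  have "lp_mass p (\<lambda>x. f x / a) = lp_mass p f / norm a powr p"
    unfolding lp_mass_def by (simp add: norm_divide powr_divide)
  then show "bergman_norm p \<Omega> (\<lambda>x. f x / a) = bergman_norm p \<Omega> f / norm a"
    unfolding bergman_norm_eq[OF A] bergman_norm_eq[OF f]
    using p lp_mass_nonneg[of p f] by (simp add: powr_divide powr_powr)
qed

lemma min_norm_pos:
  assumes op: "open \<Omega>" and z: "z \<in> \<Omega>" and f: "bergman_minimizer p \<Omega> z f"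
  shows "min_norm p \<Omega> z > 0"
proof -
  have "f \<in> bergman_space p \<Omega>" "f z \<noteq> 0" using f by (auto simp: bergman_minimizer_def)
  with lp_mass_pos[OF op this(1) z] have "bergman_norm p \<Omega> f > 0"
    by (simp add: bergman_norm_eq)
  then show ?thesis using f by (simp add: bergman_minimizer_def)
qed

text \<open>
  Rescaled to the value 1 at \<open>z\<close>, the minimiser at \<open>w\<close> competes at \<open>z\<close>. Equality
  makes the rescaled function a minimiser at \<open>z\<close>, which is possible only for \<open>z = w\<close>.
\<close>
lemma norm_minimizer_le:
  fixes \<Omega> :: "(complex ^ 'n) set"
  assumes op: "open \<Omega>" and bd: "bounded \<Omega>" and p: "p \<ge> 1" and zw: "z \<in> \<Omega>" "w \<in> \<Omega>"
    and f: "bergman_minimizer p \<Omega> w f" and pos: "min_norm p \<Omega> z > 0" "min_norm p \<Omega> w > 0"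
  shows "norm (f z) \<le> min_norm p \<Omega> w / min_norm p \<Omega> z"
    and "norm (f z) = min_norm p \<Omega> w / min_norm p \<Omega> z \<longleftrightarrow> z = w"
proof -
  have fA: "f \<in> bergman_space p \<Omega>" and fw: "f w = 1" and fn: "bergman_norm p \<Omega> f = min_norm p \<Omega> w"
    using f by (auto simp: bergman_minimizer_def)
  let ?g = "\<lambda>x. f x / f z"
  note g = bergman_norm_divide[OF op p fA, of "f z", unfolded fn]
  show "norm (f z) \<le> min_norm p \<Omega> w / min_norm p \<Omega> z"
  proof (cases "f z = 0")
    case False
    then have "min_norm p \<Omega> z \<le> min_norm p \<Omega> w / norm (f z)"
      using min_norm_le[OF g(1), of z] g(2) by simp
    then show ?thesis using False pos by (simp add: field_simps)
  qed (use pos in simp)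
  show "norm (f z) = min_norm p \<Omega> w / min_norm p \<Omega> z \<longleftrightarrow> z = w"
  proof
    assume eq: "norm (f z) = min_norm p \<Omega> w / min_norm p \<Omega> z"
    then have nz: "f z \<noteq> 0" using pos by auto
    have "bergman_minimizer p \<Omega> z ?g"
      unfolding bergman_minimizer_def using g nz eq pos by simp
    from bergman_minimizers_proportional_imp_eq[OF op bd p zw(2) f this nz] show "z = w" .
  next
    assume "z = w"
    then show "norm (f z) = min_norm p \<Omega> w / min_norm p \<Omega> z" using fw pos by simp
  qed
qed

text \<open>
  In terms of \<open>m = min_norm p \<Omega>\<close>, the right-hand side is \<open>(m w / m z) * m w powr (- p)\<close> and the left-hand
  side is \<open>norm (minimizer p \<Omega> w z) * m w powr (- p)\<close>, so this is the bound on the minimiser in disguise.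
\<close>
lemma bergman_kernel_bound:
  fixes \<Omega> :: "(complex ^ 'n) set"
  assumes dom: "domain_cn \<Omega>" and bd: "bounded \<Omega>" and p: "p \<ge> 1" and zw: "z \<in> \<Omega>" "w \<in> \<Omega>"
  defines "R \<equiv> bergman_kernel_diag p \<Omega> z powr (1 / p) * bergman_kernel_diag p \<Omega> w powr conj_exponent_recip p"
  shows "norm (bergman_kernel p \<Omega> z w) \<le> R" and "norm (bergman_kernel p \<Omega> z w) = R \<longleftrightarrow> z = w"
proof -
  have op: "open \<Omega>" and con: "connected \<Omega>" using dom by (auto simp: domain_cn_def)
  note minimizer = bergman_minimizer_minimizer[OF op con bd p]
  define m where "m = min_norm p \<Omega>"
  have mz: "m z > 0" and mw: "m w > 0"
    unfolding m_def using min_norm_pos[OF op _ minimizer] zw by blast+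
  have "R = m z powr (- 1) * m w powr (1 + - p)"
    using p by (simp add: R_def bergman_kernel_diag_def conj_exponent_recip_def m_def powr_powr algebra_simps)
  also have "\<dots> = (m w / m z) * m w powr (- p)"
    using mz mw by (simp add: powr_diff powr_minus_divide)
  finally have R: "R = (m w / m z) * m w powr (- p)" .
  have K: "norm (bergman_kernel p \<Omega> z w) = norm (minimizer p \<Omega> w z) * m w powr (- p)"
    by (simp add: bergman_kernel_def bergman_kernel_diag_def norm_mult m_def)
  note val = norm_minimizer_le[OF op bd p zw minimizer[OF zw(2)], folded m_def, OF mz mw]
  show "norm (bergman_kernel p \<Omega> z w) \<le> R"
    unfolding K R using val(1) by (rule mult_right_mono) simp
  have "m w powr (- p) \<noteq> 0" using mw by simp
  from mult_right_cancel[OF this] val(2)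
  show "norm (bergman_kernel p \<Omega> z w) = R \<longleftrightarrow> z = w"
    unfolding K R by blast
qed

text \<open>
  The second inequality is the sum of the first for \<open>(z, w)\<close> and for \<open>(w, z)\<close>, followed by Young's
  inequality with weights \<open>1 / p\<close> and \<open>1 - 1 / p\<close>: the two weighted means add up to
  \<open>K\<^sub>p(z) + K\<^sub>p(w)\<close>. Equality at the end forces equality in the first.
\<close>
theorem theorem1p3:
  fixes \<Omega> :: "(complex ^ 'n) set" and p :: real and z w :: "complex ^ 'n"
  assumes "domain_cn \<Omega>" and "bounded \<Omega>" and "p \<ge> 1"
    and "z \<in> \<Omega>" and "w \<in> \<Omega>"
  shows "(norm (bergman_kernel p \<Omega> z w) \<le>
           bergman_kernel_diag p \<Omega> z powr (1 / p) *
           bergman_kernel_diag p \<Omega> w powr conj_exponent_recip p) \<and>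
         (norm (bergman_kernel p \<Omega> z w) =
           bergman_kernel_diag p \<Omega> z powr (1 / p) *
           bergman_kernel_diag p \<Omega> w powr conj_exponent_recip p \<longleftrightarrow> z = w) \<and>
         (Re (bergman_kernel p \<Omega> z w + bergman_kernel p \<Omega> w z) \<le>
           bergman_kernel_diag p \<Omega> z + bergman_kernel_diag p \<Omega> w) \<and>
         (Re (bergman_kernel p \<Omega> z w + bergman_kernel p \<Omega> w z) =
           bergman_kernel_diag p \<Omega> z + bergman_kernel_diag p \<Omega> w \<longleftrightarrow> z = w)"
proof -
  let ?K = "bergman_kernel p \<Omega>" and ?D = "bergman_kernel_diag p \<Omega>"
  let ?b = "\<lambda>x y. ?D x powr (1 / p) * ?D y powr conj_exponent_recip p"
  note zw = bergman_kernel_bound[OF assms] and wz = bergman_kernel_bound[OF assms(1-3,5,4)]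
  have young: "?b x y \<le> 1 / p * ?D x + (1 - 1 / p) * ?D y" if "x \<in> \<Omega>" "y \<in> \<Omega>" for x y
  proof -
    have op: "open \<Omega>" and con: "connected \<Omega>" using assms(1) by (auto simp: domain_cn_def)
    have "?D u > 0" if "u \<in> \<Omega>" for u
      using min_norm_pos[OF op that bergman_minimizer_minimizer[OF op con assms(2,3) that]]
      by (simp add: bergman_kernel_diag_def)
    with that show ?thesis
      unfolding conj_exponent_recip_def using assms(3) by (intro Youngs_inequality_0) auto
  qed
  have sum: "?b z w + ?b w z \<le> ?D z + ?D w"
    using young[OF assms(4,5)] young[OF assms(5,4)] by (simp add: algebra_simps)
  have Re_le: "Re (?K z w) \<le> norm (?K z w)" "Re (?K w z) \<le> norm (?K w z)"
    by (rule complex_Re_le_cmod)+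
  have le: "Re (?K z w + ?K w z) \<le> ?D z + ?D w"
    using sum Re_le zw(1) wz(1) by simp
  have eq: "Re (?K z w + ?K w z) = ?D z + ?D w \<longleftrightarrow> z = w"
  proof
    assume "Re (?K z w + ?K w z) = ?D z + ?D w"
    then have "norm (?K z w) = ?b z w"
      using sum Re_le zw(1) wz(1) by simp
    then show "z = w" using zw(2) by blast
  next
    assume "z = w"
    moreover have "minimizer p \<Omega> z z = 1"
      using bergman_minimizer_minimizer[of \<Omega> p z] assms by (simp add: domain_cn_def bergman_minimizer_def)
    ultimately show "Re (?K z w + ?K w z) = ?D z + ?D w"
      by (simp add: bergman_kernel_def)
  qed
  show ?thesis using zw le eq by blast
qed

end
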